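(* Let $\lambda_{BS}>0$, $p\in(0,1)$, $P_{macro},P_{micro}>0$, $\beta>2$, $\lambda_{SU}>0$. Let $\Phi_{macro},\Phi_{micro}$ be independent homogeneous Poisson point processes on $\mathbb{R}^2$ of intensities $p\lambda_{BS}$ and $(1-p)\lambda_{BS}$, and $\mathcal{U}_{static}$ an independent homogeneous Poisson point process of intensity $\lambda_{SU}$ (static users). Let $\overline N_{SU,het}=\mathbf{E}^0_{SU}[|\mathcal{U}_{static}(V_{het}(0))|]$, where under the Palm distribution $\mathbf{E}^0_{SU}$ of the static users (a typical static user at the origin), $V_{het}(0)$ is the hetnet cell containing the origin. Then, writing $x=(x_1,x_2)$, $y=(y_1,y_2)$, $$\overline N_{SU,het}=1+\lambda_{SU}\lambda_{BS}p\int_{\mathbb{R}^4}e^{-\lambda_{BS}p\,\mathcal{A}(x,y)}e^{-\lambda_{BS}(1-p)\mathcal{B}(x,y)}\,dx\,dy+\lambda_{SU}\lambda_{BS}(1-p)\int_{\mathbb{R}^4}e^{-\lambda_{BS}(1-p)\mathcal{A}(x,y)}e^{-\lambda_{BS}p\,\mathcal{D}(x,y)}\,dx\,dy,$$ where $\mathcal{A}(x,y)$, $\mathcal{B}(x,y)$, $\mathcal{D}(x,y)$ are the areas of the union of the disc centered at $x$ and the disc centered at $y$ with radii, respectively, $(|x|,|y|)$, $\big((P_{micro}/P_{macro})^{1/\beta}|x|,(P_{micro}/P_{macro})^{1/\beta}|y|\big)$, and $\big((P_{macro}/P_{micro})^{1/\beta}|x|,(P_{macro}/P_{micro})^{1/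\beta}|y|\big)$.
   Context: With $\Phi=\Phi_{macro}\cup\Phi_{micro}$ and $P_i=P_{macro}$ for macro stations, $P_i=P_{micro}$ for micro stations, the hetnet cell of a station $X_i\in\Phi$ is the set of $z\in\mathbb{R}^2$ with $P_i|X_i-z|^{-\beta}\ge P_j|X_j-z|^{-\beta}$ for all $X_j\in\Phi$; static users are served by the station whose hetnet cell contains them. $|\mathcal{U}_{static}(B)|$ is the number of static users in $B$ (including the typical one). *)

theory Defs
  imports "HOL-Probability.Probability"
begin

type_synonym pt = "real \<times> real"

definition cnt :: "('w \<Rightarrow> pt set) \<Rightarrow> pt set \<Rightarrow> 'w \<Rightarrow> nat" where
  "cnt \<Phi> B \<omega> = card (\<Phi> \<omega> \<inter> B)"

definition is_PPP :: "'w measure \<Rightarrow> real \<Rightarrow> ('w \<Rightarrow> pt set) \<Rightarrow> bool" where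
  "is_PPP M lam \<Phi> \<longleftrightarrow>
     (\<forall>\<omega>\<in>space M. \<forall>B. bounded B \<longrightarrow> finite (\<Phi> \<omega> \<inter> B)) \<and>
     (\<forall>B\<in>sets lborel. bounded B \<longrightarrow>
        cnt \<Phi> B \<in> measurable M (count_space UNIV) \<and>
        (\<forall>k. measure M {\<omega>\<in>space M. cnt \<Phi> B \<omega> = k}
              = (lam * measure lborel B) ^ k / fact k * exp (- lam * measure lborel B))) \<and>
     (\<forall>(F :: nat \<Rightarrow> pt set) n.
        (\<forall>i<n. F i \<in> sets lborel \<and> bounded (F i)) \<and> disjoint_family_on F {..<n} \<longrightarrow>
        prob_space.indep_vars M (\<lambda>_. count_space UNIV) (\<lambda>i. cnt \<Phi> (F i)) {..<n})"

definition pp_sigma :: "'w measure \<Rightarrow> ('w \<Rightarrow> pt set) \<Rightarrow> 'w set set" where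
  "pp_sigma M \<Phi> = sigma_sets (space M)
     {cnt \<Phi> B -` {k} \<inter> space M | B k. B \<in> sets lborel \<and> bounded B}"

definition indep_pp3 :: "'w measure \<Rightarrow> ('w \<Rightarrow> pt set) \<Rightarrow> ('w \<Rightarrow> pt set) \<Rightarrow> ('w \<Rightarrow> pt set) \<Rightarrow> bool" where
  "indep_pp3 M \<Phi>1 \<Phi>2 \<Phi>3 \<longleftrightarrow>
     prob_space.indep_sets M
       (\<lambda>i::nat. pp_sigma M (if i = 0 then \<Phi>1 else if i = 1 then \<Phi>2 else \<Phi>3)) {0, 1, 2}"

definition pow_of :: "pt set \<Rightarrow> real \<Rightarrow> real \<Rightarrow> pt \<Rightarrow> real" where
  "pow_of Mac Pmac Pmic X = (if X \<in> Mac then Pmac else Pmic)"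

text \<open>Hetnet cell of station X: points z with P_X |X-z|^(-beta) \<ge> P_Y |Y-z|^(-beta) for all
  stations Y, written in multiplied-out form (P_Y |X-z|^beta \<le> P_X |Y-z|^beta) so that it is
  also meaningful at the station locations.\<close>
definition het_cell :: "pt set \<Rightarrow> pt set \<Rightarrow> real \<Rightarrow> real \<Rightarrow> real \<Rightarrow> pt \<Rightarrow> pt set" where
  "het_cell Mac Mic Pmac Pmic \<beta> X =
     {z. \<forall>Y \<in> Mac \<union> Mic. pow_of Mac Pmac Pmic Y * dist X z powr \<beta>
                          \<le> pow_of Mac Pmac Pmic X * dist Y z powr \<beta>}"

definition serving :: "pt set \<Rightarrow> pt set \<Rightarrow> real \<Rightarrow> real \<Rightarrow> real \<Rightarrow> pt \<Rightarrow> pt" where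
  "serving Mac Mic Pmac Pmic \<beta> u =
     (SOME X. X \<in> Mac \<union> Mic \<and> u \<in> het_cell Mac Mic Pmac Pmic \<beta> X)"

definition users_in_cell ::
  "pt set \<Rightarrow> pt set \<Rightarrow> pt set \<Rightarrow> real \<Rightarrow> real \<Rightarrow> real \<Rightarrow> pt \<Rightarrow> nat" where
  "users_in_cell Mac Mic U Pmac Pmic \<beta> u =
     card (U \<inter> het_cell Mac Mic Pmac Pmic \<beta> (serving Mac Mic Pmac Pmic \<beta> u))"

text \<open>Palm expectation (w.r.t. the stationary static-user process of intensity lamSU) of the
  number of static users in the hetnet cell of the typical user, via the Campbell--Mecke
  definition of the Palm distribution, using the unit square as reference window.\<close>
definition palm_users_het ::
  "'w measure \<Rightarrow> real \<Rightarrow> ('w \<Rightarrow> pt set) \<Rightarrow> ('w \<Rightarrow> pt set) \<Rightarrow> ('w \<Rightarrow> pt set)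
    \<Rightarrow> real \<Rightarrow> real \<Rightarrow> real \<Rightarrow> ennreal" where
  "palm_users_het M lamSU Mac Mic U Pmac Pmic \<beta> =
     (\<integral>\<^sup>+ \<omega>. ennreal (real (\<Sum>u \<in> U \<omega> \<inter> ({0..1} \<times> {0..1}).
          users_in_cell (Mac \<omega>) (Mic \<omega>) (U \<omega>) Pmac Pmic \<beta> u)) \<partial>M)
     / ennreal (lamSU * measure lborel ({0..1::real} \<times> {0..1::real}))"

definition union_area :: "real \<Rightarrow> pt \<Rightarrow> pt \<Rightarrow> real" where
  "union_area c x y = measure lborel (ball x (c * norm x) \<union> ball y (c * norm y))"

end

theory Submission
  imports Defs
begin

text \<open>
  Count ordered pairs of distinct static users, the first one in the unit square, that lie in a
  common cell. Mecke's formula, applied to both users and to the common station \<open>X\<close>, turns the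
  expected number of pairs \<open>(u, v)\<close> into an integral over \<open>u\<close>, \<open>v\<close>, \<open>X\<close> of the probability that no
  station falls into the discs around \<open>u\<close> and \<open>v\<close> in which it would beat \<open>X\<close>. By independence this
  is a product of two void probabilities, and translating \<open>X\<close> to the origin gives the integral over
  pairs of points; the diagonal contributes the summand 1. Almost surely no user is tied between
  two stations, and cells contain finitely many users because the expectation is finite.

  Mecke's formula only has to be checked on rectangles \<open>B \<times> {S. S \<inter> A = {}}\<close>: these form a
  \<open>\<pi>\<close>-system, and the void events generate the whole \<open>\<sigma>\<close>-algebra, counts included.
\<close>

section \<open>Locally finite configurations\<close>

text \<open>The definitions carry default values that the formula does not tolerate:
  \<open>card\<close> of an infinite set is 0, \<open>serving\<close> chooses by
  \<open>SOME\<close>, and \<open>pow_of\<close> gives a point lying in both tiers the macro power.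
  The pathwise identity between user counts and pairs is therefore proved off an event that must be
  shown to be null. Finiteness of the cells is not shown geometrically: the expected number of pairs
  is computed in \<open>ennreal\<close>, where it makes sense without that knowledge, and its
  finiteness then bounds the number of users in the cells met by the window. The expectation needs
  measurability of sums over random sets. Such sums are written as integrals against
  \<open>count_space\<close>, and void conditions as the vanishing of such a sum, so that a few
  closure rules make nested sums and point deletions measurable automatically. Independence enters
  by turning expectations into iterated integrals over three laws; after that, every null event is a
  sum over violating tuples whose iterated integral is zero.\<close>

definition locally_finite :: "'a::euclidean_space set \<Rightarrow> bool" where
  "locally_finite S \<longleftrightarrow> (\<forall>B. bounded B \<longrightarrow> finite (S \<inter> B))"

text \<open>This small generator keeps two later checks short: a map into \<open>configs\<close> is
  tested on void events alone, and the generator is stable under intersection, since avoiding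
  \<open>A\<close> and \<open>A'\<close> means avoiding \<open>A \<union> A'\<close>.\<close>

definition configs :: "'a::euclidean_space set measure" where
  "configs = sigma {S. locally_finite S}
     {{S. locally_finite S \<and> S \<inter> A = {}} | A. A \<in> sets borel \<and> bounded A}"

lemma locally_finite_subset: "locally_finite S \<Longrightarrow> T \<subseteq> S \<Longrightarrow> locally_finite T"
  unfolding locally_finite_def by (meson Int_mono finite_subset order_refl)

lemma locally_finite_Diff [intro]: "locally_finite S \<Longrightarrow> locally_finite (S - T)"
  by (rule locally_finite_subset) auto

lemma space_configs: "space configs = {S. locally_finite S}"
  unfolding configs_def by (subst space_measure_of) auto

lemma sets_configs:
  "sets configs = sigma_sets {S. locally_finite S}
     {{S. locally_finite S \<and> S \<inter> A = {}} | A. A \<in> sets borel \<and> bounded A}"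
  unfolding configs_def by (subst sets_measure_of) auto

lemma void_in_sets_configs:
  assumes "A \<in> sets borel" "bounded A"
  shows "{S \<in> space configs. S \<inter> A = {}} \<in> sets configs"
  using assms by (auto simp: sets_configs space_configs)

lemma measurable_configsI:
  fixes K :: "'b \<Rightarrow> 'a::euclidean_space set"
  assumes "\<And>z. z \<in> space N \<Longrightarrow> locally_finite (K z)"
    and "\<And>A. A \<in> sets borel \<Longrightarrow> bounded A \<Longrightarrow> {z \<in> space N. K z \<inter> A = {}} \<in> sets N"
  shows "K \<in> measurable N configs"
  unfolding configs_def
proof (rule measurable_measure_of)
  fix X :: "'a set set"
  assume "X \<in> {{S. locally_finite S \<and> S \<inter> A = {}} | A. A \<in> sets borel \<and> bounded A}"
  then obtain A :: "'a set" where A: "X = {S. locally_finite S \<and> S \<inter> A = {}}" "A \<in> sets borel" "bounded A"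
    by blast
  have "K -` X \<inter> space N = {z \<in> space N. K z \<inter> A = {}}"
    using assms(1) A(1) by auto
  then show "K -` X \<inter> space N \<in> sets N" using assms(2) A by simp
qed (use assms(1) in auto)

text \<open>Expresses counts through void events, since a countable basis separates finitely many points.\<close>

lemma card_Int_ge_iff_separated:
  fixes S :: "'a::metric_space set"
  assumes fin: "finite (S \<inter> B)" and base: "topological_basis \<C>"
  shows "m \<le> card (S \<inter> B) \<longleftrightarrow>
    (\<exists>\<A>. \<A> \<subseteq> \<C> \<and> finite \<A> \<and> card \<A> = m \<and> disjoint \<A> \<and> (\<forall>A\<in>\<A>. S \<inter> (A \<inter> B) \<noteq> {}))"
    (is "_ \<longleftrightarrow> (\<exists>\<A>. ?P \<A>)")
proof
  assume "m \<le> card (S \<inter> B)"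
  then obtain T where T: "T \<subseteq> S \<inter> B" "card T = m" "finite T"
    by (meson obtain_subset_with_card_n)
  have "\<forall>x\<in>T. \<exists>d>0. \<forall>y\<in>T. y \<noteq> x \<longrightarrow> d \<le> dist x y"
    using finite_set_avoid[OF T(3)] by blast
  then obtain d where d: "\<And>x. x \<in> T \<Longrightarrow> d x > 0"
      "\<And>x y. x \<in> T \<Longrightarrow> y \<in> T \<Longrightarrow> y \<noteq> x \<Longrightarrow> d x \<le> dist x y"
    by metis
  \<comment> \<open>Half of a lower bound for the distance to the other points of \<open>T\<close>:
    by the triangle inequality, balls with these radii around distinct points are disjoint.\<close>
  have "\<exists>A\<in>\<C>. x \<in> A \<and> A \<subseteq> ball x (d x / 2)" if "x \<in> T" for x
    using topological_basisE[OF base open_ball, of x x "d x / 2"] d(1)[OF that] by (metis centre_in_ball half_gt_zero)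
  then obtain A where A: "\<And>x. x \<in> T \<Longrightarrow> A x \<in> \<C>" "\<And>x. x \<in> T \<Longrightarrow> x \<in> A x"
      "\<And>x. x \<in> T \<Longrightarrow> A x \<subseteq> ball x (d x / 2)"
    by metis
  have disj: "A x \<inter> A y = {}" if "x \<in> T" "y \<in> T" "x \<noteq> y" for x y
  proof -
    { fix z assume z: "z \<in> A x" "z \<in> A y"
      have "dist x z < d x / 2" "dist y z < d y / 2"
        using z A(3) that by (auto simp: subset_eq)
      moreover have "dist x y \<le> dist x z + dist y z" by (metis dist_commute dist_triangle)
      moreover have "d x \<le> dist x y" "d y \<le> dist x y"
        using d(2)[of x y] d(2)[of y x] that by (auto simp: dist_commute)
      ultimately have False by linarith }
    then show ?thesis by blast
  qed
  then have "inj_on A T"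
    by (intro inj_onI) (metis A(2) Int_iff empty_iff)
  then have "card (A ` T) = m" using T by (simp add: card_image)
  moreover have "disjoint (A ` T)"
    unfolding disjoint_def using disj by blast
  moreover have "\<forall>C\<in>A ` T. S \<inter> (C \<inter> B) \<noteq> {}" using T A(2) by blast
  moreover have "A ` T \<subseteq> \<C>" using A(1) by blast
  ultimately have "?P (A ` T)" using T by simp
  then show "\<exists>\<A>. ?P \<A>" by blast
next
  assume "\<exists>\<A>. ?P \<A>"
  then obtain \<A> where \<A>: "finite \<A>" "card \<A> = m" "disjoint \<A>"
      "\<forall>A\<in>\<A>. S \<inter> (A \<inter> B) \<noteq> {}" by (elim exE conjE)
  then have "\<forall>A\<in>\<A>. \<exists>x. x \<in> S \<inter> (A \<inter> B)" by (simp only: ex_in_conv)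
  then obtain f where f: "\<And>A. A \<in> \<A> \<Longrightarrow> f A \<in> S \<inter> (A \<inter> B)" by metis
  have "inj_on f \<A>"
    by (intro inj_onI) (metis \<A>(3) f disjoint_def Int_iff empty_iff)
  then have "card \<A> = card (f ` \<A>)" by (simp add: card_image)
  also have "\<dots> \<le> card (S \<inter> B)" using f by (intro card_mono fin) auto
  finally show "m \<le> card (S \<inter> B)" using \<A> by simp
qed

text \<open>A countable basis has countably many finite subfamilies, so having at least
  \<open>m\<close> points is a countable union of finite intersections of complements of void
  events. An exact count is a difference of two such events.\<close>

lemma measurable_card_configs:
  fixes B :: "'a::euclidean_space set"
  assumes "B \<in> sets borel" "bounded B"
  shows "(\<lambda>S. card (S \<inter> B)) \<in> measurable configs (count_space UNIV)"
proof -
  obtain \<C> :: "'a set set" where \<C>: "countable \<C>" "topological_basis \<C>"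
    using ex_countable_basis by blast
  have ge: "{S \<in> space configs. m \<le> card (S \<inter> B)} \<in> sets configs" for m
  proof -
    let ?T = "{\<A>. \<A> \<subseteq> \<C> \<and> finite \<A> \<and> card \<A> = m \<and> disjoint \<A>}"
    have "countable ?T"
      by (rule countable_subset[OF _ countable_Collect_finite_subset[OF \<C>(1)]]) auto
    moreover have "{S \<in> space configs. \<forall>A\<in>\<A>. \<not> (S \<inter> (A \<inter> B) = {})} \<in> sets configs"
      if "\<A> \<in> ?T" for \<A>
    proof (intro sets.sets_Collect_finite_All sets.sets_Collect_neg void_in_sets_configs)
      fix A assume "A \<in> \<A>"
      then have "open A" using that \<C> topological_basis_open by blast
      then show "A \<inter> B \<in> sets borel" using assms by simp
    qed (use that assms in auto)
    ultimately have "{S \<in> space configs. \<exists>\<A>\<in>?T. \<forall>A\<in>\<A>. \<not> (S \<inter> (A \<inter> B) = {})} \<in> sets configs"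
      by (intro sets.sets_Collect_countable_Ex') auto
    also have "{S \<in> space configs. \<exists>\<A>\<in>?T. \<forall>A\<in>\<A>. \<not> (S \<inter> (A \<inter> B) = {})} =
        {S \<in> space configs. m \<le> card (S \<inter> B)}"
    proof (rule Collect_cong, rule conj_cong[OF refl])
      fix S :: "'a set" assume "S \<in> space configs"
      then have "finite (S \<inter> B)" using assms by (simp add: space_configs locally_finite_def)
      from card_Int_ge_iff_separated[OF this \<C>(2), of m]
      show "(\<exists>\<A>\<in>?T. \<forall>A\<in>\<A>. \<not> (S \<inter> (A \<inter> B) = {})) \<longleftrightarrow> m \<le> card (S \<inter> B)" by simp
    qed
    finally show ?thesis .
  qed
  have "{S \<in> space configs. card (S \<inter> B) = m} \<in> sets configs" for m
  proof -
    have "{S \<in> space configs. card (S \<inter> B) = m} =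
        {S \<in> space configs. m \<le> card (S \<inter> B)} - {S \<in> space configs. Suc m \<le> card (S \<inter> B)}"
      by auto
    then show ?thesis using ge by auto
  qed
  moreover have "(\<lambda>S. card (S \<inter> B)) -` {m} \<inter> space configs = {S \<in> space configs. card (S \<inter> B) = m}" for m
    by auto
  ultimately show ?thesis
    by (subst measurable_count_space_eq2_countable) auto
qed

section \<open>Measurability of sums over a random configuration\<close>

lemma nn_integral_count_space_SUP_cball:
  fixes f :: "'a::euclidean_space \<Rightarrow> ennreal"
  shows "(\<integral>\<^sup>+ y. f y \<partial>count_space S) = (SUP m. \<integral>\<^sup>+ y. f y \<partial>count_space (S \<inter> cball 0 (real m)))"
proof -
  have "(SUP m. f y * indicator (cball 0 (real m)) y) = f y" for y
  proof (rule antisym)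
    obtain m where "norm y \<le> real m" using real_arch_simple by blast
    then show "f y \<le> (SUP m. f y * indicator (cball 0 (real m)) y)"
      by (intro SUP_upper2[of m]) auto
  qed (auto intro!: SUP_least split: split_indicator)
  then have "(\<integral>\<^sup>+ y. f y \<partial>count_space S) = (\<integral>\<^sup>+ y. (SUP m. f y * indicator (cball 0 (real m)) y) \<partial>count_space S)"
    by simp
  also have "\<dots> = (SUP m. \<integral>\<^sup>+ y. f y * indicator (cball 0 (real m)) y \<partial>count_space S)"
    by (intro nn_integral_monotone_convergence_SUP)
       (auto simp: incseq_def le_fun_def split: split_indicator)
  also have "\<dots> = (SUP m. \<integral>\<^sup>+ y. f y \<partial>count_space (S \<inter> cball 0 (real m)))"
    by (intro SUP_cong refl)
       (auto simp: nn_integral_count_space_indicator intro!: nn_integral_cong split: split_indicator)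
  finally show ?thesis .
qed

text \<open>Dynkin argument in \<open>Q\<close>. The complement step subtracts two sums in
  \<open>ennreal\<close>, so it is carried out inside a bounded window, where the number of points
  is finite; the window is then exhausted by balls.\<close>

lemma nn_integral_config_measurable_indicator:
  fixes K :: "'b \<Rightarrow> 'a::euclidean_space set"
  assumes K[measurable]: "K \<in> measurable N configs" and Q: "Q \<in> sets (N \<Otimes>\<^sub>M borel)"
  shows "(\<lambda>z. \<integral>\<^sup>+ y. indicator Q (z, y) \<partial>count_space (K z)) \<in> borel_measurable N"
proof -
  have card_meas: "(\<lambda>z. of_nat (card (K z \<inter> B)) :: ennreal) \<in> borel_measurable N"
    if "B \<in> sets borel" "bounded B" for B
    using measurable_compose[OF K measurable_card_configs[OF that]] by measurable
  have lf: "finite (K z \<inter> B)" if "z \<in> space N" "bounded B" for z B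
    using measurable_space[OF K that(1)] that(2) by (simp add: space_configs locally_finite_def)
  have bdd: "(\<lambda>z. \<integral>\<^sup>+ y. indicator Q (z, y) \<partial>count_space (K z \<inter> B)) \<in> borel_measurable N"
    if B: "B \<in> sets borel" "bounded B" for B
    using Int_stable_pair_measure_generator pair_measure_closed Q unfolding sets_pair_measure
  proof (induct rule: sigma_sets_induct_disjoint)
    case (basic A)
    then obtain a b where A: "A = a \<times> b" "a \<in> sets N" "b \<in> sets borel" by blast
    have "(\<integral>\<^sup>+ y. indicator A (z, y) \<partial>count_space (K z \<inter> B)) =
        indicator a z * of_nat (card (K z \<inter> (b \<inter> B)))" if "z \<in> space N" for z
    proof -
      have "(\<integral>\<^sup>+ y. indicator A (z, y) \<partial>count_space (K z \<inter> B)) =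
          (\<Sum>y\<in>K z \<inter> B. indicator a z * indicator b y)"
        by (subst nn_integral_count_space_finite[OF lf[OF that B(2)]])
           (auto simp: A indicator_times intro!: sum.cong)
      also have "\<dots> = indicator a z * of_nat (card (K z \<inter> B \<inter> b))"
        using sum_mult_indicator[OF lf[OF that B(2)], of "\<lambda>_. indicator a z :: ennreal" "\<lambda>_. b" "\<lambda>y. y"]
        by (simp only: sum_constant mult.commute Collect_conj_eq Collect_mem_eq)
      finally show ?thesis by (simp add: ac_simps)
    qed
    moreover have "(\<lambda>z. indicator a z * of_nat (card (K z \<inter> (b \<inter> B))) :: ennreal) \<in> borel_measurable N"
      using A B by (intro borel_measurable_times_ennreal card_meas) (auto intro: bounded_Int)
    ultimately show ?case by (simp cong: measurable_cong)
  next
    case empty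
    then show ?case by simp
  next
    case (compl A)
    have "(\<integral>\<^sup>+ y. indicator (space N \<times> space borel - A) (z, y) \<partial>count_space (K z \<inter> B)) =
        of_nat (card (K z \<inter> B)) - (\<integral>\<^sup>+ y. indicator A (z, y) \<partial>count_space (K z \<inter> B))"
      if z: "z \<in> space N" for z
    proof -
      have "(\<integral>\<^sup>+ y. indicator (space N \<times> space borel - A) (z, y) \<partial>count_space (K z \<inter> B)) =
        (\<integral>\<^sup>+ y. 1 - indicator A (z, y) \<partial>count_space (K z \<inter> B))"
        using z by (intro nn_integral_cong) (auto split: split_indicator)
      also have "\<dots> = (\<integral>\<^sup>+ y. 1 \<partial>count_space (K z \<inter> B)) - (\<integral>\<^sup>+ y. indicator A (z, y) \<partial>count_space (K z \<inter> B))"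
        using lf[OF z B(2)]
        by (intro nn_integral_diff) (auto simp: nn_integral_count_space_finite indicator_def)
      finally show ?thesis using lf[OF z B(2)] by (simp add: emeasure_count_space)
    qed
    then show ?case using compl(2) card_meas[OF B] by (simp cong: measurable_cong)
  next
    case (union F)
    have "(\<integral>\<^sup>+ y. indicator (\<Union>i. F i) (z, y) \<partial>count_space (K z \<inter> B)) =
       (\<Sum>i. \<integral>\<^sup>+ y. indicator (F i) (z, y) \<partial>count_space (K z \<inter> B))" for z
      using union(1) by (subst nn_integral_suminf[symmetric]) (auto simp: suminf_indicator)
    then show ?case using union(3) by simp
  qed
  have "(\<lambda>z. SUP m. \<integral>\<^sup>+ y. indicator Q (z, y) \<partial>count_space (K z \<inter> cball 0 (real m))) \<in> borel_measurable N"
    by (rule borel_measurable_SUP[OF countableI_type]) (rule bdd; simp)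
  then show ?thesis
    by (simp only: nn_integral_count_space_SUP_cball[symmetric])
qed

text \<open>Summand and configuration may both depend on the parameter \<open>z\<close>, so repeated
  use of this rule covers nested sums such as those in \<open>cell_pairs\<close>.\<close>

lemma borel_measurable_nn_integral_config [measurable (raw)]:
  fixes K :: "'b \<Rightarrow> 'a::euclidean_space set"
  assumes f: "case_prod f \<in> borel_measurable (N \<Otimes>\<^sub>M borel)"
    and K[measurable]: "K \<in> measurable N configs"
  shows "(\<lambda>z. \<integral>\<^sup>+ y. f z y \<partial>count_space (K z)) \<in> borel_measurable N"
proof -
  have "(\<lambda>z. \<integral>\<^sup>+ y. F (z, y) \<partial>count_space (K z)) \<in> borel_measurable N"
    if "F \<in> borel_measurable (N \<Otimes>\<^sub>M borel)" for F
    using that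
  proof (induct rule: borel_measurable_induct)
    case (cong F G)
    then have "(\<integral>\<^sup>+ y. F (z, y) \<partial>count_space (K z)) = (\<integral>\<^sup>+ y. G (z, y) \<partial>count_space (K z))"
      if "z \<in> space N" for z
      using that by (intro nn_integral_cong) (auto simp: space_pair_measure)
    then show ?case using cong by (simp cong: measurable_cong)
  next
    case (set A)
    then show ?case by (rule nn_integral_config_measurable_indicator[OF K])
  qed (simp_all add: nn_integral_cmult nn_integral_add nn_integral_monotone_convergence_SUP
      incseq_def le_fun_def image_comp)
  from this[OF f] show ?thesis by simp
qed

lemma countable_locally_finite:
  fixes S :: "'a::euclidean_space set"
  assumes "locally_finite S"
  shows "countable S"
proof -
  have "S = (\<Union>m. S \<inter> cball 0 (real m))"
    by (auto simp: real_arch_simple)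
  moreover have "countable (S \<inter> cball 0 (real m))" for m
    using assms by (intro countable_finite) (auto simp: locally_finite_def)
  ultimately show ?thesis by (metis countable_UN countableI_type)
qed

text \<open>Mecke's formula evaluates its integrand at the configuration without the chosen point.
  Avoiding \<open>A\<close> after the deletion means that a sum over the whole of \<open>K z\<close>
  vanishes in which the deleted point has weight 0.\<close>

lemma measurable_config_Diff_point [measurable (raw)]:
  fixes K :: "'b \<Rightarrow> 'a::euclidean_space set"
  assumes K[measurable]: "K \<in> measurable N configs" and x[measurable]: "x \<in> measurable N borel"
  shows "(\<lambda>z. K z - {x z}) \<in> measurable N configs"
proof (rule measurable_configsI)
  fix z assume "z \<in> space N"
  then show "locally_finite (K z - {x z})"
    using measurable_space[OF K] by (auto simp: space_configs intro: locally_finite_subset)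
next
  fix A :: "'a set" assume A[measurable]: "A \<in> sets borel"
  have "{z \<in> space N. (K z - {x z}) \<inter> A = {}} =
      {z \<in> space N. (\<integral>\<^sup>+ y. indicator A y * (if y = x z then 0 else 1) \<partial>count_space (K z)) = 0}"
    by (auto simp: nn_integral_0_iff_AE AE_count_space split: split_indicator if_splits)
  also have "\<dots> \<in> sets N" by measurable
  finally show "{z \<in> space N. (K z - {x z}) \<inter> A = {}} \<in> sets N" .
qed

lemma emeasure_lborel_bounded:
  "bounded A \<Longrightarrow> emeasure lborel A = ennreal (measure lborel A)"
proof (rule emeasure_eq_ennreal_measure)
  assume "bounded A"
  from emeasure_bounded_finite[OF this] show "emeasure lborel A \<noteq> top" by (simp add: less_top)
qed

section \<open>Mecke's formula\<close>

lemma count_void_in_sets_configs: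
  fixes A B :: "'a::euclidean_space set"
  assumes "A \<in> sets borel" "bounded A" "B \<in> sets borel" "bounded B"
  shows "{S \<in> space configs. card (S \<inter> B) = k \<and> S \<inter> A = {}} \<in> sets configs"
proof -
  have "{S \<in> space configs. card (S \<inter> B) = k \<and> S \<inter> A = {}} =
      ((\<lambda>S. card (S \<inter> B)) -` {k} \<inter> space configs) \<inter> {S \<in> space configs. S \<inter> A = {}}"
    by auto
  then show ?thesis
    using void_in_sets_configs[OF assms(1,2)] measurable_sets[OF measurable_card_configs[OF assms(3,4)], of "{k}"] by simp
qed

text \<open>Independence over disjoint sets is condensed into the joint law of one count and one
  void event; void probabilities, mean counts and Mecke's formula all follow from it.\<close>

locale poisson_law = prob_space P for P :: "'a::euclidean_space set measure" and lam :: real +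
  assumes sets_eq: "sets P = sets configs"
    and lam_nonneg: "0 \<le> lam"
    and prob_count_void: "\<And>A B k. A \<in> sets borel \<Longrightarrow> bounded A \<Longrightarrow> B \<in> sets borel \<Longrightarrow> bounded B \<Longrightarrow> A \<inter> B = {} \<Longrightarrow>
      prob {S \<in> space configs. card (S \<inter> B) = k \<and> S \<inter> A = {}} =
        (lam * measure lborel B) ^ k / fact k * exp (- lam * measure lborel B) * exp (- lam * measure lborel A)"
begin

lemmas sets_eq_configs [measurable_cong, simp] = sets_eq

lemma space_eq [simp]: "space P = space configs"
  using sets_eq by (rule sets_eq_imp_space_eq)

lemma emeasure_count_void:
  assumes "A \<in> sets borel" "bounded A" "B \<in> sets borel" "bounded B" "A \<inter> B = {}"
  shows "emeasure P {S \<in> space configs. card (S \<inter> B) = k \<and> S \<inter> A = {}} =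
    ennreal ((lam * measure lborel B) ^ k / fact k * exp (- lam * measure lborel B) * exp (- lam * measure lborel A))"
  using prob_count_void[OF assms] by (simp add: emeasure_eq_measure)

lemma emeasure_void:
  assumes "A \<in> sets borel" "bounded A"
  shows "emeasure P {S \<in> space configs. S \<inter> A = {}} = ennreal (exp (- lam * measure lborel A))"
  \<comment> \<open>The empty set contains 0 points with certainty: its factor is
    \<open>0 ^ 0 / fact 0 * exp 0 = 1\<close>.\<close>
  using emeasure_count_void[OF assms, of "{}" 0] by simp

lemma nn_integral_count_void:
  assumes AB: "A \<in> sets borel" "bounded A" "B \<in> sets borel" "bounded B" "A \<inter> B = {}"
  shows "(\<integral>\<^sup>+ S. of_nat (card (S \<inter> B)) * indicator {S \<in> space configs. S \<inter> A = {}} S \<partial>P) =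
    ennreal (lam * measure lborel B * exp (- lam * measure lborel A))"
proof -
  let ?\<mu> = "lam * measure lborel B" and ?E = "\<lambda>k. {S \<in> space configs. card (S \<inter> B) = k \<and> S \<inter> A = {}}"
  have [measurable]: "?E k \<in> sets P" for k using count_void_in_sets_configs[OF AB(1-4)] by simp
  have eq: "of_nat (card (S \<inter> B)) * indicator {S \<in> space configs. S \<inter> A = {}} S =
      (\<Sum>k. of_nat k * indicator (?E k) S :: ennreal)" for S
  proof -
    have "(\<lambda>k. of_nat k * indicator (?E k) S :: ennreal) =
       (\<lambda>k. if k = card (S \<inter> B) then of_nat (card (S \<inter> B)) * indicator {S \<in> space configs. S \<inter> A = {}} S else 0)"
      by (auto simp: fun_eq_iff split: split_indicator)
    then show ?thesis
      using sums_unique[OF sums_single[of "card (S \<inter> B)"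
        "\<lambda>_. of_nat (card (S \<inter> B)) * indicator {S \<in> space configs. S \<inter> A = {}} S :: ennreal"]] by simp
  qed
  have "(\<integral>\<^sup>+ S. of_nat (card (S \<inter> B)) * indicator {S \<in> space configs. S \<inter> A = {}} S \<partial>P) =
      (\<Sum>k. \<integral>\<^sup>+ S. of_nat k * indicator (?E k) S \<partial>P)"
    unfolding eq by (rule nn_integral_suminf) measurable
  also have "\<dots> = (\<Sum>k. of_nat k * emeasure P (?E k))"
    using count_void_in_sets_configs[OF AB(1-4)] by (simp add: nn_integral_cmult_indicator)
  also have "\<dots> = (\<Sum>k. ennreal (real k * (?\<mu> ^ k / fact k * exp (- ?\<mu>) * exp (- lam * measure lborel A))))"
    by (simp only: emeasure_count_void[OF AB] ennreal_of_nat_eq_real_of_nat ennreal_mult'[symmetric] of_nat_0_le_iff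
        minus_mult_left[symmetric])
  also have "\<dots> = ennreal (?\<mu> * exp (- lam * measure lborel A))"
  proof (rule suminf_ennreal_eq)
    show "0 \<le> real k * (?\<mu> ^ k / fact k * exp (- ?\<mu>) * exp (- lam * measure lborel A))" for k
      using lam_nonneg by simp
    \<comment> \<open>The term with \<open>k = 0\<close> is 0; shifting the index by one cancels the
      factor \<open>k\<close> against the factorial and leaves \<open>?\<mu>\<close> times the
      exponential series.\<close>
    have "(\<lambda>k. real (Suc k) * (?\<mu> ^ Suc k / fact (Suc k))) = (\<lambda>k. ?\<mu> * (?\<mu> ^ k /\<^sub>R fact k))"
      by (rule ext) (simp add: field_simps del: of_nat_Suc)
    then have "(\<lambda>k. real (Suc k) * (?\<mu> ^ Suc k / fact (Suc k))) sums (?\<mu> * exp ?\<mu>)"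
      using sums_mult[OF exp_converges[of ?\<mu>]] by metis
    then have "(\<lambda>k. real k * (?\<mu> ^ k / fact k)) sums (?\<mu> * exp ?\<mu>)"
      using sums_Suc_iff[of "\<lambda>k. real k * (?\<mu> ^ k / fact k)" "?\<mu> * exp ?\<mu>"] by simp
    from sums_mult2[OF this, of "exp (- ?\<mu>) * exp (- lam * measure lborel A)"]
    have "(\<lambda>k. real k * (?\<mu> ^ k / fact k * exp (- ?\<mu>) * exp (- lam * measure lborel A))) sums
        (?\<mu> * (exp ?\<mu> * exp (- ?\<mu>)) * exp (- lam * measure lborel A))"
      by (simp only: mult.assoc)
    then show "(\<lambda>k. real k * (?\<mu> ^ k / fact k * exp (- ?\<mu>) * exp (- lam * measure lborel A))) sums
        (?\<mu> * exp (- lam * measure lborel A))"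
      by (simp only: exp_add[symmetric] right_minus exp_zero mult_1_right)
  qed
  finally show ?thesis .
qed

end

text \<open>
  The sum depends only on whether \<open>S \<inter> A\<close> is empty or a singleton, so its expectation needs just the
  joint law of a count and a void event.
\<close>

lemma sum_rectangle_void:
  fixes S :: "'a::euclidean_space set"
  assumes S: "locally_finite S" and A: "bounded A" and B: "bounded B"
  shows "(\<integral>\<^sup>+ x. indicator B x * indicator {S. locally_finite S \<and> S \<inter> A = {}} (S - {x}) \<partial>count_space S) =
     of_nat (card (S \<inter> (B - A))) * indicator {S. locally_finite S \<and> S \<inter> A = {}} S
       + indicator {S. locally_finite S \<and> card (S \<inter> (B \<inter> A)) = 1 \<and> S \<inter> (A - B) = {}} S"
    (is "?L = ?R")
proof -
  have fin: "finite (S \<inter> B)" using S B by (simp add: locally_finite_def)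
  have lf: "locally_finite (S - {x})" for x using S by auto
  have "?L = (\<integral>\<^sup>+ x. indicator {x. (S - {x}) \<inter> A = {}} x \<partial>count_space (S \<inter> B))"
    by (auto simp: nn_integral_count_space_indicator lf intro!: nn_integral_cong split: split_indicator)
  also have "\<dots> = (\<Sum>x\<in>S \<inter> B. indicator {x. (S - {x}) \<inter> A = {}} x)"
    by (rule nn_integral_count_space_finite[OF fin])
  also have "\<dots> = ?R"
  proof -
    \<comment> \<open>If \<open>S \<inter> A\<close> is a singleton, only the deletion of that very
      point empties it, and this counts exactly if the point lies in \<open>B\<close>. With two
      points in \<open>A\<close> no single deletion suffices.\<close>
    consider "S \<inter> A = {}" | a where "S \<inter> A = {a}" | a b where "a \<in> S \<inter> A" "b \<in> S \<inter> A" "a \<noteq> b"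
      by blast
    then show ?thesis
    proof cases
      case 1
      then have "(\<Sum>x\<in>S \<inter> B. indicator {x. (S - {x}) \<inter> A = {}} x :: ennreal) = (\<Sum>x\<in>S \<inter> B. 1)"
        by (intro sum.cong) (auto split: split_indicator)
      moreover have "S \<inter> B = S \<inter> (B - A)" "S \<inter> (B \<inter> A) = {}" using 1 by auto
      ultimately show ?thesis using 1 S by simp
    next
      case (2 a)
      then have "(\<Sum>x\<in>S \<inter> B. indicator {x. (S - {x}) \<inter> A = {}} x :: ennreal) = (\<Sum>x\<in>S \<inter> B. if x = a then 1 else 0)"
        by (intro sum.cong) (auto split: split_indicator)
      also have "\<dots> = (if a \<in> B then 1 else 0)" using fin 2 by (auto simp: sum.delta)
      finally have *: "(\<Sum>x\<in>S \<inter> B. indicator {x. (S - {x}) \<inter> A = {}} x :: ennreal) = (if a \<in> B then 1 else 0)" .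
      have "S \<inter> (B \<inter> A) = (if a \<in> B then {a} else {})" "S \<inter> (A - B) = (if a \<in> B then {} else {a})"
        using 2 by auto
      then show ?thesis using 2 S by (simp add: *)
    next
      case (3 a b)
      then have "(\<Sum>x\<in>S \<inter> B. indicator {x. (S - {x}) \<inter> A = {}} x :: ennreal) = (\<Sum>x\<in>S \<inter> B. 0)"
        by (intro sum.cong) (auto split: split_indicator)
      moreover have "\<not> (card (S \<inter> (B \<inter> A)) = 1 \<and> S \<inter> (A - B) = {})"
      proof
        assume *: "card (S \<inter> (B \<inter> A)) = 1 \<and> S \<inter> (A - B) = {}"
        then obtain c where "S \<inter> (B \<inter> A) = {c}" by (auto simp: card_1_singleton_iff)
        moreover have "a \<in> S \<inter> (B \<inter> A)" "b \<in> S \<inter> (B \<inter> A)" using 3 * by auto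
        ultimately show False using 3(3) by auto
      qed
      moreover have "S \<inter> A \<noteq> {}" using 3 by auto
      ultimately show ?thesis by simp
    qed
  qed
  finally show ?thesis .
qed

context poisson_law
begin

text \<open>Either \<open>x\<close> lies in \<open>B - A\<close> and \<open>A\<close> is void, or
  \<open>x\<close> is the only point in \<open>A\<close> and lies in \<open>B\<close>. Both cases
  carry the same exponential factor, because the measures of \<open>B \<inter> A\<close> and
  \<open>A - B\<close> add up to that of \<open>A\<close>; the prefactors then add up to the measure
  of \<open>B\<close>.\<close>

lemma mecke_rectangle:
  assumes A: "A \<in> sets borel" "bounded A" and B: "B \<in> sets borel" "bounded B"
  shows "(\<integral>\<^sup>+ S. \<integral>\<^sup>+ x. indicator B x * indicator {S \<in> space configs. S \<inter> A = {}} (S - {x}) \<partial>count_space S \<partial>P) =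
    ennreal (lam * measure lborel B * exp (- lam * measure lborel A))"
proof -
  have bdd: "bounded (B - A)" "bounded (A - B)" "bounded (B \<inter> A)"
    using A B by (auto intro: bounded_subset)
  have fin: "emeasure lborel X \<noteq> \<infinity>" if "bounded X" for X :: "'a set"
    using emeasure_bounded_finite[OF that] by auto
  have V: "{S. locally_finite S \<and> S \<inter> X = {}} = {S \<in> space configs. S \<inter> X = {}}" for X :: "'a set"
    by (simp add: space_configs)
  let ?E = "{S \<in> space configs. card (S \<inter> (B \<inter> A)) = 1 \<and> S \<inter> (A - B) = {}}"
  have E: "?E \<in> sets configs"
    using A B bdd by (intro count_void_in_sets_configs) auto
  have "(\<integral>\<^sup>+ S. \<integral>\<^sup>+ x. indicator B x * indicator {S \<in> space configs. S \<inter> A = {}} (S - {x}) \<partial>count_space S \<partial>P) =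
      (\<integral>\<^sup>+ S. of_nat (card (S \<inter> (B - A))) * indicator {S \<in> space configs. S \<inter> A = {}} S + indicator ?E S \<partial>P)"
    using A B by (intro nn_integral_cong)
      (simp only: space_eq space_configs mem_Collect_eq sum_rectangle_void)
  also have "\<dots> = (\<integral>\<^sup>+ S. of_nat (card (S \<inter> (B - A))) * indicator {S \<in> space configs. S \<inter> A = {}} S \<partial>P)
      + emeasure P ?E"
  proof (subst nn_integral_add)
    have [measurable]: "(\<lambda>S. card (S \<inter> (B - A))) \<in> measurable configs (count_space UNIV)"
      using A B bdd by (intro measurable_card_configs) auto
    have [measurable]: "{S \<in> space configs. S \<inter> A = {}} \<in> sets configs"
      using A by (intro void_in_sets_configs)
    show "(\<lambda>S. of_nat (card (S \<inter> (B - A))) * indicator {S \<in> space configs. S \<inter> A = {}} S :: ennreal) \<in> borel_measurable P"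
      by measurable
  qed (use E in simp_all)
  also have "\<dots> = ennreal (lam * measure lborel (B - A) * exp (- lam * measure lborel A)) +
      ennreal (lam * measure lborel (B \<inter> A) * exp (- lam * measure lborel (B \<inter> A)) * exp (- lam * measure lborel (A - B)))"
    using A B bdd by (subst nn_integral_count_void, simp_all only: Diff_disjoint sets.Diff)
      (subst emeasure_count_void; auto)
  also have "measure lborel A = measure lborel (B \<inter> A) + measure lborel (A - B)"
  proof -
    have "A = (B \<inter> A) \<union> (A - B)" by blast
    then show ?thesis
      using measure_Union[OF fin[OF bdd(3)] fin[OF bdd(2)]] A B by auto
  qed
  also have "ennreal (lam * measure lborel (B - A) * exp (- lam * (measure lborel (B \<inter> A) + measure lborel (A - B)))) +
      ennreal (lam * measure lborel (B \<inter> A) * exp (- lam * measure lborel (B \<inter> A)) * exp (- lam * measure lborel (A - B))) =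
      ennreal (lam * (measure lborel (B - A) + measure lborel (B \<inter> A)) * exp (- lam * (measure lborel (B \<inter> A) + measure lborel (A - B))))"
  proof -
    have "exp (- lam * b) * exp (- lam * c) = exp (- lam * (b + c))" for b c
      by (simp add: exp_add[symmetric] algebra_simps)
    then show ?thesis
      using lam_nonneg by (subst ennreal_plus[symmetric]) (simp_all only: mult.assoc distrib_left distrib_right
          measure_nonneg mult_nonneg_nonneg exp_ge_zero)
  qed
  also have "measure lborel (B - A) + measure lborel (B \<inter> A) = measure lborel B"
  proof -
    have "B = (B - A) \<union> (B \<inter> A)" "(B - A) \<inter> (B \<inter> A) = {}" by blast+
    then show ?thesis
      using measure_Union[OF fin[OF bdd(1)] fin[OF bdd(3)]] A B by auto
  qed
  also have "measure lborel (B \<inter> A) + measure lborel (A - B) = measure lborel A"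
    using \<open>measure lborel A = _\<close> by simp
  finally show ?thesis .
qed

text \<open>With the left-hand side of Mecke's formula turned into a measure on pairs of a point and
  the remaining configuration, the formula becomes an equality of measures, to which uniqueness on a
  generator applies.\<close>

definition reduced_campbell :: "('a \<times> 'a set) measure" where
  "reduced_campbell = measure_of (space (borel \<Otimes>\<^sub>M configs)) (sets (borel \<Otimes>\<^sub>M configs))
     (\<lambda>E. \<integral>\<^sup>+ S. \<integral>\<^sup>+ x. indicator E (x, S - {x}) \<partial>count_space S \<partial>P)"

lemma sets_reduced_campbell [simp, measurable_cong]: "sets reduced_campbell = sets (borel \<Otimes>\<^sub>M configs)"
  unfolding reduced_campbell_def by (rule sets.sets_measure_of_eq)

lemma emeasure_reduced_campbell:
  assumes "E \<in> sets (borel \<Otimes>\<^sub>M configs)"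
  shows "emeasure reduced_campbell E = (\<integral>\<^sup>+ S. \<integral>\<^sup>+ x. indicator E (x, S - {x}) \<partial>count_space S \<partial>P)"
  unfolding reduced_campbell_def
proof (rule emeasure_measure_of_sigma[OF sets.sigma_algebra_axioms _ _ assms])
  show "countably_additive (sets (borel \<Otimes>\<^sub>M configs))
      (\<lambda>E. \<integral>\<^sup>+ S. \<integral>\<^sup>+ x. indicator E (x, S - {x}) \<partial>count_space S \<partial>P)"
  proof (rule countably_additiveI)
    fix F :: "nat \<Rightarrow> ('a \<times> 'a set) set"
    assume F: "range F \<subseteq> sets (borel \<Otimes>\<^sub>M configs)" "disjoint_family F"
    have [measurable]: "F i \<in> sets (borel \<Otimes>\<^sub>M configs)" for i using F(1) by auto
    have "(\<Sum>i. \<integral>\<^sup>+ S. \<integral>\<^sup>+ x. indicator (F i) (x, S - {x}) \<partial>count_space S \<partial>P) =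
        (\<integral>\<^sup>+ S. (\<Sum>i. \<integral>\<^sup>+ x. indicator (F i) (x, S - {x}) \<partial>count_space S) \<partial>P)"
      by (rule nn_integral_suminf[symmetric]) measurable
    also have "\<dots> = (\<integral>\<^sup>+ S. \<integral>\<^sup>+ x. (\<Sum>i. indicator (F i) (x, S - {x})) \<partial>count_space S \<partial>P)"
      by (subst nn_integral_suminf) simp_all
    also have "\<dots> = (\<integral>\<^sup>+ S. \<integral>\<^sup>+ x. indicator (\<Union>i. F i) (x, S - {x}) \<partial>count_space S \<partial>P)"
      by (subst suminf_indicator[OF F(2)]) simp
    finally show "(\<Sum>i. \<integral>\<^sup>+ S. \<integral>\<^sup>+ x. indicator (F i) (x, S - {x}) \<partial>count_space S \<partial>P) =
        (\<integral>\<^sup>+ S. \<integral>\<^sup>+ x. indicator (\<Union>i. F i) (x, S - {x}) \<partial>count_space S \<partial>P)" .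
  qed
qed (simp add: positive_def)

lemma reduced_campbell_eq: "reduced_campbell = density (lborel \<Otimes>\<^sub>M P) (\<lambda>_. ennreal lam)"
proof -
  let ?G = "{a \<times> b | a b. a \<in> {B :: 'a set. B \<in> sets borel \<and> bounded B} \<and>
      b \<in> {{S. locally_finite S \<and> S \<inter> A = {}} | A :: 'a set. A \<in> sets borel \<and> bounded A}}"
  have gen_borel: "sets borel = sigma_sets (space borel) {B :: 'a set. B \<in> sets borel \<and> bounded B}"
  proof
    show "sigma_sets (space borel) {B :: 'a set. B \<in> sets borel \<and> bounded B} \<subseteq> sets borel"
      by (rule sets.sigma_sets_subset) auto
    have "X \<in> sigma_sets (space borel) {B. B \<in> sets borel \<and> bounded B}" if "X \<in> sets borel" for X :: "'a set"
    proof -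
      have "X = (\<Union>m. X \<inter> cball 0 (real m))" by (auto simp: real_arch_simple)
      also have "\<dots> \<in> sigma_sets (space borel) {B. B \<in> sets borel \<and> bounded B}"
        using that by (intro sigma_sets.Union sigma_sets.Basic) (auto intro: bounded_Int)
      finally show ?thesis .
    qed
    then show "sets borel \<subseteq> sigma_sets (space borel) {B :: 'a set. B \<in> sets borel \<and> bounded B}" by blast
  qed
  have gen: "sets (borel \<Otimes>\<^sub>M configs) = sigma_sets (UNIV \<times> space configs) ?G"
  proof (subst sets_pair_eq[where Ca = "range (\<lambda>m. cball 0 (real m))" and Cb = "{space configs}"])
    show "sets (sigma (space borel \<times> space configs) ?G) = sigma_sets (UNIV \<times> space configs) ?G"
      by (subst sets_measure_of) (auto simp: space_configs)
    show "\<Union>(range (\<lambda>m. cball 0 (real m))) = space (borel :: 'a measure)"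
      by (auto simp: real_arch_simple)
    show "sets borel = sigma_sets (space borel) {B :: 'a set. B \<in> sets borel \<and> bounded B}"
      by (rule gen_borel)
    show "{space configs} \<subseteq> {{S. locally_finite S \<and> S \<inter> A = {}} | A :: 'a set. A \<in> sets borel \<and> bounded A}"
      by (auto simp: space_configs intro!: exI[of _ "{}"])
  qed (auto simp: sets_configs space_configs)
  have sets_R: "sets (density (lborel \<Otimes>\<^sub>M P) (\<lambda>_. ennreal lam)) = sets (borel \<Otimes>\<^sub>M configs)"
    by (simp cong: sets_pair_measure_cong)
  have rect: "emeasure reduced_campbell (B \<times> {S \<in> space configs. S \<inter> A = {}}) =
        ennreal (lam * measure lborel B * exp (- lam * measure lborel A))"
    if "A \<in> sets borel" "bounded A" "B \<in> sets borel" "bounded B" for A B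
    using that by (subst emeasure_reduced_campbell)
      (simp_all add: void_in_sets_configs indicator_times mecke_rectangle[OF that, simplified])
  show ?thesis
  proof (rule measure_eqI_generator_eq[where E = ?G and \<Omega> = "UNIV \<times> space configs"
        and A = "\<lambda>m. cball 0 (real m) \<times> space configs"])
    show "Int_stable ?G"
    proof (rule Int_stableI)
      fix X Y assume "X \<in> ?G" "Y \<in> ?G"
      then obtain B A B' A' :: "'a set" where
        X: "X = B \<times> {S. locally_finite S \<and> S \<inter> A = {}}" "B \<in> sets borel" "bounded B" "A \<in> sets borel" "bounded A" and
        Y: "Y = B' \<times> {S. locally_finite S \<and> S \<inter> A' = {}}" "B' \<in> sets borel" "bounded B'" "A' \<in> sets borel" "bounded A'"
        by blast
      have "X \<inter> Y = (B \<inter> B') \<times> {S. locally_finite S \<and> S \<inter> (A \<union> A') = {}}"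
        unfolding X Y by blast
      moreover have "B \<inter> B' \<in> sets borel" "bounded (B \<inter> B')" "A \<union> A' \<in> sets borel" "bounded (A \<union> A')"
        using X Y by (auto intro: bounded_Int)
      ultimately show "X \<inter> Y \<in> ?G" by blast
    qed
    show "?G \<subseteq> Pow (UNIV \<times> space configs)" by (auto simp: space_configs)
    fix X assume "X \<in> ?G"
    then obtain B A :: "'a set" where
        X: "X = B \<times> {S \<in> space configs. S \<inter> A = {}}" and BA: "B \<in> sets borel" "bounded B" "A \<in> sets borel" "bounded A"
      by (auto simp: space_configs)
    have "emeasure (density (lborel \<Otimes>\<^sub>M P) (\<lambda>_. ennreal lam)) X =
        ennreal lam * emeasure (lborel \<Otimes>\<^sub>M P) (B \<times> {S \<in> space configs. S \<inter> A = {}})"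
      using BA unfolding X by (subst emeasure_density) (auto simp: void_in_sets_configs nn_integral_cmult_indicator)
    also have "\<dots> = ennreal lam * (ennreal (measure lborel B) * ennreal (exp (- lam * measure lborel A)))"
      using BA by (subst emeasure_pair_measure_Times)
        (auto simp: void_in_sets_configs emeasure_void emeasure_lborel_bounded)
    also have "\<dots> = ennreal (lam * measure lborel B * exp (- lam * measure lborel A))"
      using lam_nonneg by (simp add: ennreal_mult mult.assoc)
    finally show "emeasure reduced_campbell X = emeasure (density (lborel \<Otimes>\<^sub>M P) (\<lambda>_. ennreal lam)) X"
      using rect[OF BA(3,4,1,2)] X by simp
  next
    show "sets reduced_campbell = sigma_sets (UNIV \<times> space configs) ?G" using gen by simp
    show "sets (density (lborel \<Otimes>\<^sub>M P) (\<lambda>_. ennreal lam)) = sigma_sets (UNIV \<times> space configs) ?G"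
      using gen sets_R by simp
    \<comment> \<open>The exhausting sets must belong to the generator and have finite measure; the
      full space of configurations is the void event of the empty set.\<close>
    show "range (\<lambda>m. cball 0 (real m) \<times> space configs) \<subseteq> ?G"
    proof -
      have "space configs = {S :: 'a set. locally_finite S \<and> S \<inter> {} = {}}" by (simp add: space_configs)
      then show ?thesis by (intro image_subsetI CollectI exI conjI) (rule refl, auto)
    qed
    show "(\<Union>m. cball 0 (real m) \<times> space configs) = UNIV \<times> space configs"
      by (auto simp: real_arch_simple)
    show "emeasure reduced_campbell (cball 0 (real m) \<times> space configs) \<noteq> \<infinity>" for m
      using rect[of "{}" "cball 0 (real m)"] by simp
  qed
qed

lemma nn_integral_reduced_campbell:
  assumes f: "f \<in> borel_measurable (borel \<Otimes>\<^sub>M configs)"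
  shows "(\<integral>\<^sup>+ z. f z \<partial>reduced_campbell) = (\<integral>\<^sup>+ S. \<integral>\<^sup>+ x. f (x, S - {x}) \<partial>count_space S \<partial>P)"
  using f
proof (induct rule: borel_measurable_induct)
  case (cong f g)
  have "(\<integral>\<^sup>+ z. f z \<partial>reduced_campbell) = (\<integral>\<^sup>+ z. g z \<partial>reduced_campbell)"
    using cong(3) sets_eq_imp_space_eq[OF sets_reduced_campbell] by (intro nn_integral_cong) auto
  moreover have "(\<integral>\<^sup>+ S. \<integral>\<^sup>+ x. f (x, S - {x}) \<partial>count_space S \<partial>P) = (\<integral>\<^sup>+ S. \<integral>\<^sup>+ x. g (x, S - {x}) \<partial>count_space S \<partial>P)"
    using cong(3) by (intro nn_integral_cong)
      (simp add: space_pair_measure space_configs locally_finite_Diff)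
  ultimately show ?case using cong(4) by simp
next
  case (set A)
  then show ?case by (simp add: emeasure_reduced_campbell)
next
  case (mult f c)
  note [measurable] = mult(2)
  show ?case using mult by (simp add: nn_integral_cmult)
next
  case (add f g)
  note [measurable] = add(1,3)
  show ?case using add by (simp add: nn_integral_add)
next
  case (seq F)
  note [measurable] = seq(1)
  have mono: "incseq (\<lambda>i S. \<integral>\<^sup>+ x. F i (x, S - {x}) \<partial>count_space S)"
    using seq(4) by (auto simp: incseq_def le_fun_def intro!: nn_integral_mono)
  have "(\<integral>\<^sup>+ z. (SUP i. F i z) \<partial>reduced_campbell) = (SUP i. \<integral>\<^sup>+ S. \<integral>\<^sup>+ x. F i (x, S - {x}) \<partial>count_space S \<partial>P)"
    using seq(1,3,4) by (subst nn_integral_monotone_convergence_SUP) simp_all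
  also have "\<dots> = (\<integral>\<^sup>+ S. (SUP i. \<integral>\<^sup>+ x. F i (x, S - {x}) \<partial>count_space S) \<partial>P)"
    by (rule nn_integral_monotone_convergence_SUP[symmetric, OF mono]) measurable
  also have "\<dots> = (\<integral>\<^sup>+ S. \<integral>\<^sup>+ x. (SUP i. F i (x, S - {x})) \<partial>count_space S \<partial>P)"
    using seq(4) by (subst nn_integral_monotone_convergence_SUP) (auto simp: incseq_def le_fun_def)
  finally show ?case by (simp add: image_comp SUP_apply)
qed

text \<open>Slivnyak's principle in integrated form: seen from one of its points, the rest of a
  Poisson process has the law of the whole process.\<close>

lemma mecke:
  assumes f[measurable]: "case_prod f \<in> borel_measurable (borel \<Otimes>\<^sub>M configs)"
  shows "(\<integral>\<^sup>+ S. \<integral>\<^sup>+ x. f x (S - {x}) \<partial>count_space S \<partial>P) = ennreal lam * (\<integral>\<^sup>+ x. \<integral>\<^sup>+ S. f x S \<partial>P \<partial>lborel)"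
proof -
  have "(\<integral>\<^sup>+ S. \<integral>\<^sup>+ x. f x (S - {x}) \<partial>count_space S \<partial>P) = (\<integral>\<^sup>+ z. case_prod f z \<partial>reduced_campbell)"
    by (simp add: nn_integral_reduced_campbell[OF f])
  also have "\<dots> = (\<integral>\<^sup>+ z. ennreal lam * case_prod f z \<partial>(lborel \<Otimes>\<^sub>M P))"
    unfolding reduced_campbell_eq by (subst nn_integral_density) measurable
  also have "\<dots> = ennreal lam * (\<integral>\<^sup>+ x. \<integral>\<^sup>+ S. f x S \<partial>P \<partial>lborel)"
    by (subst nn_integral_cmult, measurable) (simp add: nn_integral_fst[symmetric])
  finally show ?thesis .
qed

end

section \<open>Independent Poisson processes\<close>

lemma is_PPP_locally_finite:
  assumes "is_PPP M lam \<Phi>" "\<omega> \<in> space M"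
  shows "locally_finite (\<Phi> \<omega>)"
  using assms by (auto simp: is_PPP_def locally_finite_def)

text \<open>An infinite intersection would also have \<open>cnt\<close> equal to 0; local finiteness
  excludes it.\<close>

lemma is_PPP_void_eq:
  assumes "is_PPP M lam \<Phi>" "bounded A"
  shows "{\<omega> \<in> space M. \<Phi> \<omega> \<inter> A = {}} = cnt \<Phi> A -` {0} \<inter> space M"
  using assms by (auto simp: is_PPP_def cnt_def)

lemma pp_sigma_subset: "pp_sigma M \<Phi> \<subseteq> Pow (space M)"
  unfolding pp_sigma_def
  using sigma_sets_into_sp[of "{cnt \<Phi> B -` {k} \<inter> space M | B k. B \<in> sets lborel \<and> bounded B}" "space M"] by blast

lemma sets_sigma_pp_sigma: "sets (sigma (space M) (pp_sigma M \<Phi>)) = pp_sigma M \<Phi>"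
proof -
  have "sets (sigma (space M) (pp_sigma M \<Phi>)) = sigma_sets (space M) (pp_sigma M \<Phi>)"
    by (rule sets_measure_of[OF pp_sigma_subset])
  also have "\<dots> = pp_sigma M \<Phi>"
    unfolding pp_sigma_def by (rule sigma_sets_sigma_sets_eq) auto
  finally show ?thesis .
qed

text \<open>The independence hypothesis speaks about the sigma-algebras generated by the counts, so
  measurability is needed with respect to these and not only with respect to
  \<open>M\<close>.\<close>

lemma is_PPP_measurable_pp_sigma:
  assumes PPP: "is_PPP M lam \<Phi>"
  shows "\<Phi> \<in> measurable (sigma (space M) (pp_sigma M \<Phi>)) configs"
proof (rule measurable_configsI)
  have space: "space (sigma (space M) (pp_sigma M \<Phi>)) = space M"
    by (rule space_measure_of[OF pp_sigma_subset])
  fix A :: "pt set" assume A: "A \<in> sets borel" "bounded A"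
  have "cnt \<Phi> A -` {0} \<inter> space M \<in> pp_sigma M \<Phi>"
    unfolding pp_sigma_def using A by (intro sigma_sets.Basic) auto
  then show "{z \<in> space (sigma (space M) (pp_sigma M \<Phi>)). \<Phi> z \<inter> A = {}} \<in> sets (sigma (space M) (pp_sigma M \<Phi>))"
    unfolding space is_PPP_void_eq[OF PPP A(2)] sets_sigma_pp_sigma .
qed (use is_PPP_locally_finite[OF PPP] in \<open>simp add: space_measure_of_conv\<close>)

lemma is_PPP_measurable:
  assumes PPP: "is_PPP M lam \<Phi>"
  shows "\<Phi> \<in> measurable M configs"
proof (rule measurable_configsI)
  fix A :: "pt set" assume A: "A \<in> sets borel" "bounded A"
  then have "cnt \<Phi> A \<in> measurable M (count_space UNIV)"
    using PPP by (simp add: is_PPP_def)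
  then show "{\<omega> \<in> space M. \<Phi> \<omega> \<inter> A = {}} \<in> sets M"
    unfolding is_PPP_void_eq[OF PPP A(2)] by (rule measurable_sets) simp
qed (rule is_PPP_locally_finite[OF PPP])

lemma (in prob_space) is_PPP_poisson_law:
  assumes PPP: "is_PPP M lam \<Phi>" and lam: "0 \<le> lam"
  shows "poisson_law (distr M configs \<Phi>) lam"
proof -
  note [measurable] = is_PPP_measurable[OF PPP]
  show ?thesis
  proof (intro poisson_law.intro poisson_law_axioms.intro prob_space_distr)
    fix A B :: "pt set" and k
    assume AB: "A \<in> sets borel" "bounded A" "B \<in> sets borel" "bounded B" "A \<inter> B = {}"
    \<comment> \<open>Independence is given for indexed families of disjoint sets; here it is used
      for a family of two, with the values \<open>k\<close> and 0.\<close>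
    let ?F = "\<lambda>i::nat. if i = 0 then B else A"
    have cnt: "prob (cnt \<Phi> X -` {j} \<inter> space M) = (lam * measure lborel X) ^ j / fact j * exp (- lam * measure lborel X)"
      if "X \<in> sets borel" "bounded X" for X j
    proof -
      have "cnt \<Phi> X -` {j} \<inter> space M = {\<omega> \<in> space M. cnt \<Phi> X \<omega> = j}" by auto
      then show ?thesis using PPP that by (simp add: is_PPP_def)
    qed
    have "disjoint_family_on ?F {..<2}"
      using AB(5) by (auto simp: disjoint_family_on_def)
    moreover have "\<forall>i<2. ?F i \<in> sets lborel \<and> bounded (?F i)" using AB by simp
    ultimately have "indep_vars (\<lambda>_. count_space UNIV) (\<lambda>i. cnt \<Phi> (?F i)) {..<2}"
      using is_PPP_def[THEN iffD1, OF PPP, THEN conjunct2, THEN conjunct2, THEN spec, of ?F, THEN spec, of 2, THEN mp]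
      by (simp only: simp_thms)
    from indep_varsD_finite[OF this, of "\<lambda>i. if i = 0 then {k} else {0}"]
    have prod: "prob (cnt \<Phi> B -` {k} \<inter> space M \<inter> (cnt \<Phi> A -` {0} \<inter> space M)) =
        prob (cnt \<Phi> B -` {k} \<inter> space M) * prob (cnt \<Phi> A -` {0} \<inter> space M)"
      by (simp add: numeral_2_eq_2 lessThan_Suc Int_commute mult.commute)
    have "measure (distr M configs \<Phi>) {S \<in> space configs. card (S \<inter> B) = k \<and> S \<inter> A = {}} =
        prob (\<Phi> -` {S \<in> space configs. card (S \<inter> B) = k \<and> S \<inter> A = {}} \<inter> space M)"
      using AB by (intro measure_distr[OF is_PPP_measurable[OF PPP]] count_void_in_sets_configs)
    also have "\<Phi> -` {S \<in> space configs. card (S \<inter> B) = k \<and> S \<inter> A = {}} \<inter> space M =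
        cnt \<Phi> B -` {k} \<inter> space M \<inter> {\<omega> \<in> space M. \<Phi> \<omega> \<inter> A = {}}"
      using is_PPP_locally_finite[OF PPP] by (auto simp: space_configs cnt_def)
    also have "prob \<dots> = prob (cnt \<Phi> B -` {k} \<inter> space M) * prob (cnt \<Phi> A -` {0} \<inter> space M)"
      unfolding is_PPP_void_eq[OF PPP AB(2)] by (rule prod)
    also have "\<dots> = (lam * measure lborel B) ^ k / fact k * exp (- lam * measure lborel B) * exp (- lam * measure lborel A)"
      using AB by (simp add: cnt)
    finally show "measure (distr M configs \<Phi>) {S \<in> space configs. card (S \<inter> B) = k \<and> S \<inter> A = {}} =
        (lam * measure lborel B) ^ k / fact k * exp (- lam * measure lborel B) * exp (- lam * measure lborel A)" .
  qed (use lam in simp_all)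
qed

text \<open>The joint law of the three processes is the product of their laws, because preimages of
  measurable sets of configurations lie in the independent sigma-algebras. The product over the
  indices 0, 1, 2 is then integrated one coordinate at a time.\<close>

lemma (in prob_space) nn_integral_indep_pp3:
  assumes PPP: "is_PPP M l1 \<Phi>1" "is_PPP M l2 \<Phi>2" "is_PPP M l3 \<Phi>3"
    and indep: "indep_pp3 M \<Phi>1 \<Phi>2 \<Phi>3"
    and f[measurable]: "(\<lambda>(S1, S2, S3). f S1 S2 S3) \<in> borel_measurable (configs \<Otimes>\<^sub>M configs \<Otimes>\<^sub>M configs)"
  shows "(\<integral>\<^sup>+ \<omega>. f (\<Phi>1 \<omega>) (\<Phi>2 \<omega>) (\<Phi>3 \<omega>) \<partial>M) =
    (\<integral>\<^sup>+ S1. \<integral>\<^sup>+ S2. \<integral>\<^sup>+ S3. f S1 S2 S3 \<partial>distr M configs \<Phi>3 \<partial>distr M configs \<Phi>2 \<partial>distr M configs \<Phi>1)"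
proof -
  let ?\<Phi> = "\<lambda>i::nat. if i = 0 then \<Phi>1 else if i = 1 then \<Phi>2 else \<Phi>3"
  let ?N = "\<lambda>i. distr M configs (?\<Phi> i)"
  let ?I = "{0, 1, 2::nat}"
  have PPP': "\<exists>l. is_PPP M l (?\<Phi> i)" for i using PPP by auto
  have meas [measurable]: "?\<Phi> i \<in> measurable M configs" for i
    using PPP' is_PPP_measurable by blast
  have [measurable]: "\<Phi>1 \<in> measurable M configs" "\<Phi>2 \<in> measurable M configs" "\<Phi>3 \<in> measurable M configs"
    using PPP is_PPP_measurable by blast+
  have [measurable]: "(\<lambda>x. f (a x) (b x) (c x)) \<in> borel_measurable K"
    if "a \<in> measurable K configs" "b \<in> measurable K configs" "c \<in> measurable K configs" for K :: "'z measure" and a b c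
    using measurable_compose[OF measurable_Pair[OF that(1) measurable_Pair[OF that(2,3)]] f] by simp
  interpret N: product_prob_space ?N
    by (intro product_prob_spaceI prob_space_distr meas)
  have "indep_vars (\<lambda>_. configs) ?\<Phi> ?I"
    unfolding indep_vars_def2
  proof (intro conjI ballI meas)
    have "indep_sets (\<lambda>i. pp_sigma M (?\<Phi> i)) ?I"
      using indep unfolding indep_pp3_def .
    then show "indep_sets (\<lambda>i. {?\<Phi> i -` A \<inter> space M |A. A \<in> sets configs}) ?I"
    proof (rule indep_sets_mono_sets)
      fix i
      obtain l where l: "is_PPP M l (?\<Phi> i)" using PPP' by blast
      have "?\<Phi> i -` A \<inter> space M \<in> pp_sigma M (?\<Phi> i)" if "A \<in> sets configs" for A
        using measurable_sets[OF is_PPP_measurable_pp_sigma[OF l] that]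
        by (simp only: sets_sigma_pp_sigma space_measure_of[OF pp_sigma_subset])
      then show "{?\<Phi> i -` A \<inter> space M |A. A \<in> sets configs} \<subseteq> pp_sigma M (?\<Phi> i)" by blast
    qed
  qed
  then have law: "distr M (\<Pi>\<^sub>M i\<in>?I. configs) (\<lambda>x. \<lambda>i\<in>?I. ?\<Phi> i x) = (\<Pi>\<^sub>M i\<in>?I. ?N i)"
    by (subst (asm) indep_vars_iff_distr_eq_PiM) auto
  have sets_N: "sets (PiM J ?N) = sets (PiM J (\<lambda>_. configs))" for J
    by (intro sets_PiM_cong) auto
  have "(\<integral>\<^sup>+ \<omega>. f (\<Phi>1 \<omega>) (\<Phi>2 \<omega>) (\<Phi>3 \<omega>) \<partial>M) =
      (\<integral>\<^sup>+ x. f (x 0) (x 1) (x 2) \<partial>distr M (\<Pi>\<^sub>M i\<in>?I. configs) (\<lambda>x. \<lambda>i\<in>?I. ?\<Phi> i x))"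
    by (subst nn_integral_distr) auto
  also have "\<dots> = (\<integral>\<^sup>+ x. f (x 0) (x 1) (x 2) \<partial>PiM (insert 0 (insert 1 {2})) ?N)"
    by (simp only: law)
  also have "\<dots> = (\<integral>\<^sup>+ S1. \<integral>\<^sup>+ x. f S1 (x 1) (x 2) \<partial>PiM (insert 1 {2}) ?N \<partial>?N 0)"
    by (subst N.product_nn_integral_insert_rev) auto
  also have "\<dots> = (\<integral>\<^sup>+ S1. \<integral>\<^sup>+ S2. \<integral>\<^sup>+ x. f S1 S2 (x 2) \<partial>PiM {2} ?N \<partial>?N 1 \<partial>?N 0)"
    by (intro nn_integral_cong, subst N.product_nn_integral_insert_rev) auto
  also have "\<dots> = (\<integral>\<^sup>+ S1. \<integral>\<^sup>+ S2. \<integral>\<^sup>+ S3. f S1 S2 S3 \<partial>?N 2 \<partial>?N 1 \<partial>?N 0)"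
    by (intro nn_integral_cong, subst N.product_nn_integral_singleton) auto
  finally show ?thesis by simp
qed

section \<open>Pairs of users in a common cell\<close>

text \<open>
  A station in \<open>shadow c X u v\<close> would take \<open>u\<close> or \<open>v\<close> away from \<open>X\<close>; here \<open>c = 1\<close> for a station of
  the same tier as \<open>X\<close>, and \<open>c\<close> is the \<open>\<beta>\<close>-th root of the power ratio for one of the other tier.
\<close>

definition shadow :: "real \<Rightarrow> pt \<Rightarrow> pt \<Rightarrow> pt \<Rightarrow> pt set" where
  "shadow c X u v = ball u (c * dist X u) \<union> ball v (c * dist X v)"

text \<open>Number of stations of tier \<open>S\<close> whose cell, in the presence of the other tier \<open>T\<close>, contains \<open>u\<close> and \<open>v\<close>.\<close>

definition common_servers :: "real \<Rightarrow> pt set \<Rightarrow> pt set \<Rightarrow> pt \<Rightarrow> pt \<Rightarrow> ennreal" where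
  "common_servers c S T u v =
     (\<integral>\<^sup>+ X. of_bool (S \<inter> shadow 1 X u v = {}) * of_bool (T \<inter> shadow c X u v = {}) \<partial>count_space S)"

text \<open>The inner sum runs over \<open>V - {u}\<close>: this leaves out the diagonal, which is
  counted separately, and has the form to which Mecke's formula applies.\<close>

definition cell_pairs :: "real \<Rightarrow> pt set \<Rightarrow> pt set \<Rightarrow> pt set \<Rightarrow> pt set \<Rightarrow> ennreal" where
  "cell_pairs c W S T V =
     (\<integral>\<^sup>+ u. indicator W u * (\<integral>\<^sup>+ v. common_servers c S T u v \<partial>count_space (V - {u})) \<partial>count_space V)"

text \<open>Taking the root of order \<open>\<beta>\<close> makes the comparison of received powers
  linear in the distances; this is where the radius factor of the discs comes from.\<close>

lemma scaled_powr_le_iff: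
  fixes a b P Q \<beta> :: real
  assumes "0 \<le> a" "0 \<le> b" "0 < P" "0 < Q" "0 < \<beta>"
  shows "P * a powr \<beta> \<le> Q * b powr \<beta> \<longleftrightarrow> (P / Q) powr (1 / \<beta>) * a \<le> b"
proof -
  let ?c = "(P / Q) powr (1 / \<beta>)"
  have "(?c * a) powr \<beta> = (P / Q) * a powr \<beta>"
    using assms by (simp add: powr_mult powr_powr)
  then have "P * a powr \<beta> = Q * (?c * a) powr \<beta>"
    using assms by simp
  then have "P * a powr \<beta> \<le> Q * b powr \<beta> \<longleftrightarrow> (?c * a) powr \<beta> \<le> b powr \<beta>"
    using assms by (simp only: mult_le_cancel_left_pos)
  also have "\<dots> \<longleftrightarrow> ?c * a \<le> b"
    using powr_mono2[of \<beta> "?c * a" b] powr_less_mono2[of \<beta> b "?c * a"] assms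
    by (meson less_eq_real_def linorder_not_le mult_nonneg_nonneg powr_ge_zero)
  finally show ?thesis .
qed

text \<open>Disjointness of the tiers ensures that every station of \<open>T\<close> transmits with
  \<open>Pmic\<close>, since \<open>pow_of\<close> looks only at membership in the first
  tier.\<close>

lemma het_cell_iff:
  assumes P: "0 < Pmac" "0 < Pmic" "0 < \<beta>" and disj: "S \<inter> T = {}" and X: "X \<in> S"
  shows "z \<in> het_cell S T Pmac Pmic \<beta> X \<longleftrightarrow>
    (\<forall>Y\<in>S. dist X z \<le> dist Y z) \<and> (\<forall>Y\<in>T. (Pmic / Pmac) powr (1 / \<beta>) * dist X z \<le> dist Y z)"
proof -
  have "pow_of S Pmac Pmic Y = Pmic" if "Y \<in> T" for Y using that disj by (auto simp: pow_of_def)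
  then show ?thesis
    using X P by (simp add: het_cell_def pow_of_def ball_Un scaled_powr_le_iff cong: ball_cong)
qed

text \<open>Exchanging the tiers together with their powers changes no cell, so facts about
  first-tier stations transfer to second-tier stations.\<close>

lemma het_cell_commute:
  assumes "S \<inter> T = {}" "X \<in> S \<union> T"
  shows "het_cell S T Pmac Pmic \<beta> X = het_cell T S Pmic Pmac \<beta> X"
proof -
  have eq: "pow_of S Pmac Pmic Y = pow_of T Pmic Pmac Y" if "Y \<in> S \<union> T" for Y
    using that assms(1) by (auto simp: pow_of_def)
  then show ?thesis
    unfolding het_cell_def Un_commute[of T S]
    by (intro Collect_cong ball_cong refl) (use eq assms(2) in simp)
qed

text \<open>A station takes \<open>u\<close> away from \<open>X\<close> exactly if it wins strictly,
  that is, lies in the open disc around \<open>u\<close>. A tie leaves \<open>u\<close> in the cell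
  of \<open>X\<close>, in accordance with the non-strict inequality defining cells.\<close>

lemma common_servers_eq:
  assumes P: "0 < Pmac" "0 < Pmic" "0 < \<beta>" and disj: "S \<inter> T = {}"
  shows "common_servers ((Pmic / Pmac) powr (1 / \<beta>)) S T u v =
    (\<integral>\<^sup>+ X. indicator (het_cell S T Pmac Pmic \<beta> X) u * indicator (het_cell S T Pmac Pmic \<beta> X) v \<partial>count_space S)"
  unfolding common_servers_def
proof (rule nn_integral_cong)
  fix X assume "X \<in> space (count_space S)"
  then have X: "X \<in> S" by simp
  let ?c = "(Pmic / Pmac) powr (1 / \<beta>)"
  have "S \<inter> shadow 1 X u v = {} \<and> T \<inter> shadow ?c X u v = {} \<longleftrightarrow>
      u \<in> het_cell S T Pmac Pmic \<beta> X \<and> v \<in> het_cell S T Pmac Pmic \<beta> X"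
    unfolding het_cell_iff[OF P disj X]
    by (simp add: shadow_def disjoint_iff dist_commute[of u] dist_commute[of v] not_less
        del: split_paired_All) blast
  then show "of_bool (S \<inter> shadow 1 X u v = {}) * of_bool (T \<inter> shadow ?c X u v = {}) =
      indicator (het_cell S T Pmac Pmic \<beta> X) u * (indicator (het_cell S T Pmac Pmic \<beta> X) v :: ennreal)"
    by (simp add: indicator_def flip: of_bool_conj)
qed

lemma ex_nearest:
  assumes "locally_finite S" "S \<noteq> {}"
  shows "\<exists>X\<in>S. \<forall>Y\<in>S. dist X u \<le> dist Y u"
proof -
  obtain X0 where X0: "X0 \<in> S" using assms(2) by blast
  \<comment> \<open>Points of \<open>S\<close> outside this disc are farther from \<open>u\<close>
    than \<open>X0\<close>, so a minimum over the finite set \<open>?F\<close> is a minimum over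
    \<open>S\<close>.\<close>
  let ?F = "S \<inter> cball u (dist X0 u)"
  have "finite ?F" "?F \<noteq> {}"
    using assms(1) X0 by (auto simp: locally_finite_def dist_commute)
  then have F: "finite ((\<lambda>Y. dist Y u) ` ?F)" "(\<lambda>Y. dist Y u) ` ?F \<noteq> {}" by auto
  obtain X where X: "X \<in> ?F" "dist X u = Min ((\<lambda>Y. dist Y u) ` ?F)"
    using Min_in[OF F] by (metis (no_types, lifting) imageE)
  have le: "dist X u \<le> dist Y u" if "Y \<in> ?F" for Y
    unfolding X(2) by (rule Min_le[OF F(1)]) (use that in blast)
  have "dist X u \<le> dist Y u" if "Y \<in> S" for Y
  proof (cases "Y \<in> ?F")
    case False
    then have "dist X0 u < dist Y u" using that by (simp add: dist_commute)
    moreover have "dist X u \<le> dist X0 u" using X(1) by (simp add: dist_commute)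
    ultimately show ?thesis by linarith
  qed (rule le)
  then show ?thesis using X(1) by blast
qed

text \<open>The server is the better one of the nearest stations of the two tiers; two servers would
  be tied at \<open>u\<close>.\<close>

lemma ex1_server:
  assumes P: "0 < Pmac" "0 < Pmic" "0 < \<beta>" and disj: "S \<inter> T = {}"
    and S: "locally_finite S" "S \<noteq> {}" and T: "locally_finite T" "T \<noteq> {}"
    and ties: "\<And>X Y. X \<in> S \<Longrightarrow> Y \<in> S \<Longrightarrow> X \<noteq> Y \<Longrightarrow> dist X u \<noteq> dist Y u"
      "\<And>X Y. X \<in> T \<Longrightarrow> Y \<in> T \<Longrightarrow> X \<noteq> Y \<Longrightarrow> dist X u \<noteq> dist Y u"
      "\<And>X Y. X \<in> S \<Longrightarrow> Y \<in> T \<Longrightarrow> (Pmic / Pmac) powr (1 / \<beta>) * dist X u \<noteq> dist Y u"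
  shows "\<exists>!X. X \<in> S \<union> T \<and> u \<in> het_cell S T Pmac Pmic \<beta> X"
proof -
  let ?c = "(Pmic / Pmac) powr (1 / \<beta>)" and ?d = "(Pmac / Pmic) powr (1 / \<beta>)"
  have c: "?c > 0" "?d > 0" "?d * ?c = 1"
    using P by (simp_all flip: powr_mult)
  \<comment> \<open>The factors are reciprocal, so comparisons seen from either tier can be stated
    with \<open>?c\<close>, and the single assumption on cross ties settles both mixed
    cases.\<close>
  have flip: "?d * y \<le> x \<longleftrightarrow> y \<le> ?c * x" for x y
  proof -
    have "?d * y \<le> x \<longleftrightarrow> ?c * (?d * y) \<le> ?c * x" using c(1) by simp
    also have "?c * (?d * y) = y" using c(3) by (simp add: mult.assoc[symmetric] mult.commute[of ?c])
    finally show ?thesis .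
  qed
  have inS: "u \<in> het_cell S T Pmac Pmic \<beta> X \<longleftrightarrow>
      (\<forall>Y\<in>S. dist X u \<le> dist Y u) \<and> (\<forall>Y\<in>T. ?c * dist X u \<le> dist Y u)" if "X \<in> S" for X
    by (rule het_cell_iff[OF P disj that])
  have inT: "u \<in> het_cell S T Pmac Pmic \<beta> X \<longleftrightarrow>
      (\<forall>Y\<in>T. dist X u \<le> dist Y u) \<and> (\<forall>Y\<in>S. dist X u \<le> ?c * dist Y u)" if "X \<in> T" for X
  proof -
    have "T \<inter> S = {}" using disj by blast
    from het_cell_iff[OF P(2,1,3) this that, of u] show ?thesis
      using het_cell_commute[OF disj, of X Pmac Pmic \<beta>] that by (simp add: flip)
  qed
  obtain X where X: "X \<in> S" "\<forall>Y\<in>S. dist X u \<le> dist Y u" using ex_nearest[OF S] by blast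
  obtain Y where Y: "Y \<in> T" "\<forall>Z\<in>T. dist Y u \<le> dist Z u" using ex_nearest[OF T] by blast
  have "\<exists>X. X \<in> S \<union> T \<and> u \<in> het_cell S T Pmac Pmic \<beta> X"
  proof (cases "?c * dist X u \<le> dist Y u")
    case True
    then have "u \<in> het_cell S T Pmac Pmic \<beta> X"
      unfolding inS[OF X(1)] using X Y by (meson order_trans)
    then show ?thesis using X(1) by blast
  next
    case False
    have "dist Y u \<le> ?c * dist Z u" if "Z \<in> S" for Z
    proof -
      have "?c * dist X u \<le> ?c * dist Z u" using X(2) that c(1) by simp
      then show ?thesis using False by linarith
    qed
    then have "u \<in> het_cell S T Pmac Pmic \<beta> Y"
      unfolding inT[OF Y(1)] using Y by blast
    then show ?thesis using Y(1) by blast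
  qed
  moreover have "X = Y" if XY: "X \<in> S \<union> T" "u \<in> het_cell S T Pmac Pmic \<beta> X"
      "Y \<in> S \<union> T" "u \<in> het_cell S T Pmac Pmic \<beta> Y" for X Y
  proof -
    consider "X \<in> S" "Y \<in> S" | "X \<in> T" "Y \<in> T" | "X \<in> S" "Y \<in> T" | "X \<in> T" "Y \<in> S"
      using XY(1,3) by blast
    then show ?thesis
    proof cases
      case 1 then show ?thesis using XY(2,4) inS ties(1) by (meson order_antisym)
    next
      case 2 then show ?thesis using XY(2,4) inT ties(2) by (meson order_antisym)
    next
      case 3 then show ?thesis using XY(2,4) inS inT ties(3) by (meson order_antisym)
    next
      case 4 then show ?thesis using XY(2,4) inS inT ties(3) by (meson order_antisym)
    qed
  qed
  ultimately show ?thesis by blast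
qed

text \<open>Since \<open>u\<close> has only one server, the sum over stations collapses to that
  server, and \<open>N\<close> is the number of other users in its cell; the summand 1 is
  \<open>u\<close> itself.\<close>

lemma users_in_cell_eq:
  assumes ex1: "\<exists>!X. X \<in> S \<union> T \<and> u \<in> het_cell S T Pmac Pmic \<beta> X"
    and u: "u \<in> V" and disj: "S \<inter> T = {}" and P: "0 < Pmac" "0 < Pmic" "0 < \<beta>"
    and N: "N = (\<integral>\<^sup>+ v. common_servers ((Pmic / Pmac) powr (1 / \<beta>)) S T u v +
        common_servers ((Pmac / Pmic) powr (1 / \<beta>)) T S u v \<partial>count_space (V - {u}))"
    and fin: "N \<noteq> \<infinity>"
  shows "of_nat (users_in_cell S T V Pmac Pmic \<beta> u) = 1 + N"
proof -
  let ?C = "het_cell S T Pmac Pmic \<beta>" and ?X = "serving S T Pmac Pmic \<beta> u"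
  have X: "?X \<in> S \<union> T" "u \<in> ?C ?X"
    unfolding serving_def using someI_ex[OF ex1_implies_ex[OF ex1]] by blast+
  have "common_servers ((Pmic / Pmac) powr (1 / \<beta>)) S T u v + common_servers ((Pmac / Pmic) powr (1 / \<beta>)) T S u v
      = indicator (?C ?X) v" for v
  proof -
    have "T \<inter> S = {}" using disj by blast
    have "common_servers ((Pmac / Pmic) powr (1 / \<beta>)) T S u v =
        (\<integral>\<^sup>+ X. indicator (?C X) u * indicator (?C X) v \<partial>count_space T)"
      unfolding common_servers_eq[OF P(2,1,3) \<open>T \<inter> S = {}\<close>]
      by (intro nn_integral_cong) (simp add: het_cell_commute[OF disj])
    then have "common_servers ((Pmic / Pmac) powr (1 / \<beta>)) S T u v + common_servers ((Pmac / Pmic) powr (1 / \<beta>)) T S u v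
       = (\<integral>\<^sup>+ X. indicator (?C X) u * indicator (?C X) v \<partial>count_space S) +
         (\<integral>\<^sup>+ X. indicator (?C X) u * indicator (?C X) v \<partial>count_space T)"
      by (simp add: common_servers_eq[OF P disj])
    also have "\<dots> = (\<integral>\<^sup>+ X. indicator (?C X) u * indicator (?C X) v * indicator S X +
        indicator (?C X) u * indicator (?C X) v * indicator T X \<partial>count_space UNIV)"
      by (subst nn_integral_add) (simp_all add: nn_integral_count_space_indicator)
    also have "\<dots> = (\<integral>\<^sup>+ X. indicator (?C X) u * indicator (?C X) v \<partial>count_space (S \<union> T))"
      using disj by (auto simp: nn_integral_count_space_indicator intro!: nn_integral_cong split: split_indicator)
    also have "\<dots> = (\<Sum>X\<in>{?X}. indicator (?C X) u * indicator (?C X) v)"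
      using X ex1 by (intro nn_integral_count_space') (auto split: split_indicator)
    finally show ?thesis using X by simp
  qed
  then have "N = (\<integral>\<^sup>+ v. indicator (?C ?X) v \<partial>count_space (V - {u}))"
    unfolding N by simp
  also have "\<dots> = (\<integral>\<^sup>+ v. indicator ((V - {u}) \<inter> ?C ?X) v \<partial>count_space (V - {u}))"
    by (intro nn_integral_cong) (simp split: split_indicator)
  also have "\<dots> = emeasure (count_space (V - {u})) ((V - {u}) \<inter> ?C ?X)"
    by (rule nn_integral_indicator) auto
  finally have N': "N = emeasure (count_space (V - {u})) ((V - {u}) \<inter> ?C ?X)" .
  \<comment> \<open>The counting measure of an infinite set is \<infinity>, whereas
    \<open>card\<close> would be 0; here finiteness of \<open>N\<close> is indispensable.\<close>
  have f: "finite ((V - {u}) \<inter> ?C ?X)"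
    using fin unfolding N' by (cases "finite ((V - {u}) \<inter> ?C ?X)") (simp_all add: emeasure_count_space)
  have "V \<inter> ?C ?X = insert u ((V - {u}) \<inter> ?C ?X)" using u X by blast
  then have "card (V \<inter> ?C ?X) = Suc (card ((V - {u}) \<inter> ?C ?X))" using f by simp
  then show ?thesis
    unfolding users_in_cell_def N' using f by (simp add: emeasure_count_space)
qed

lemma sum_users_in_cell_eq:
  assumes P: "0 < Pmac" "0 < Pmic" "0 < \<beta>" and fin: "finite (V \<inter> W)" and disj: "S \<inter> T = {}"
    and ex1: "\<And>u. u \<in> V \<Longrightarrow> \<exists>!X. X \<in> S \<union> T \<and> u \<in> het_cell S T Pmac Pmic \<beta> X"
    and "cell_pairs ((Pmic / Pmac) powr (1 / \<beta>)) W S T V \<noteq> \<infinity>"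
    and "cell_pairs ((Pmac / Pmic) powr (1 / \<beta>)) W T S V \<noteq> \<infinity>"
  shows "of_nat (\<Sum>u\<in>V \<inter> W. users_in_cell S T V Pmac Pmic \<beta> u) = of_nat (card (V \<inter> W)) +
    cell_pairs ((Pmic / Pmac) powr (1 / \<beta>)) W S T V + cell_pairs ((Pmac / Pmic) powr (1 / \<beta>)) W T S V"
proof -
  let ?c = "(Pmic / Pmac) powr (1 / \<beta>)" and ?d = "(Pmac / Pmic) powr (1 / \<beta>)"
  let ?N = "\<lambda>u. \<integral>\<^sup>+ v. common_servers ?c S T u v + common_servers ?d T S u v \<partial>count_space (V - {u})"
  have "cell_pairs ?c W S T V + cell_pairs ?d W T S V = (\<integral>\<^sup>+ u. indicator W u * ?N u \<partial>count_space V)"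
    unfolding cell_pairs_def
    by (subst nn_integral_add[symmetric]) (simp_all add: nn_integral_add distrib_left[symmetric])
  also have "\<dots> = (\<integral>\<^sup>+ u. ?N u \<partial>count_space (V \<inter> W))"
    by (auto simp: nn_integral_count_space_indicator[of V] nn_integral_count_space_indicator[of "V \<inter> W"]
        intro!: nn_integral_cong split: split_indicator)
  also have "\<dots> = (\<Sum>u\<in>V \<inter> W. ?N u)" by (rule nn_integral_count_space_finite[OF fin])
  finally have sum: "cell_pairs ?c W S T V + cell_pairs ?d W T S V = (\<Sum>u\<in>V \<inter> W. ?N u)" .
  \<comment> \<open>A finite total number of pairs passes on to each single user in the
    window.\<close>
  have "(\<Sum>u\<in>V \<inter> W. ?N u) \<noteq> \<infinity>"
    using assms(7,8) by (simp add: sum[symmetric])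
  then have N: "?N u \<noteq> \<infinity>" if "u \<in> V \<inter> W" for u
    using that fin by (auto simp: less_top ennreal_sum_less_top)
  have "of_nat (\<Sum>u\<in>V \<inter> W. users_in_cell S T V Pmac Pmic \<beta> u) = (\<Sum>u\<in>V \<inter> W. 1 + ?N u)"
    unfolding of_nat_sum
  proof (rule sum.cong[OF refl])
    fix u assume u: "u \<in> V \<inter> W"
    show "of_nat (users_in_cell S T V Pmac Pmic \<beta> u) = 1 + ?N u"
      by (rule users_in_cell_eq[OF ex1 _ disj P refl N[OF u]]) (use u in auto)
  qed
  also have "\<dots> = of_nat (card (V \<inter> W)) + (\<Sum>u\<in>V \<inter> W. ?N u)" by (simp add: sum.distrib)
  finally show ?thesis by (simp add: sum add.assoc)
qed

section \<open>Expected number of pairs\<close>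

text \<open>The shadow moves with the parameter, so this is no fixed void event of
  \<open>configs\<close>; it is expressed as the vanishing of a sum with a jointly measurable
  summand.\<close>

lemma pred_disjoint_shadow [measurable (raw)]:
  assumes [measurable]: "K \<in> measurable N configs"
    "X \<in> borel_measurable N" "u \<in> borel_measurable N" "v \<in> borel_measurable N"
  shows "Measurable.pred N (\<lambda>z. K z \<inter> shadow c (X z) (u z) (v z) = {})"
proof -
  have "(\<lambda>z. K z \<inter> shadow c (X z) (u z) (v z) = {}) = (\<lambda>z. (\<integral>\<^sup>+ y. of_bool (dist (u z) y < c * dist (X z) (u z)
      \<or> dist (v z) y < c * dist (X z) (v z)) \<partial>count_space (K z)) = 0)"
    by (auto simp: fun_eq_iff nn_integral_0_iff_AE AE_count_space shadow_def disjoint_iff simp del: split_paired_All)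
  also have "Measurable.pred N \<dots>" by measurable
  finally show ?thesis .
qed

lemma measurable_common_servers [measurable (raw)]:
  assumes [measurable]: "K \<in> measurable N configs" "L \<in> measurable N configs"
    "u \<in> borel_measurable N" "v \<in> borel_measurable N"
  shows "(\<lambda>z. common_servers c (K z) (L z) (u z) (v z)) \<in> borel_measurable N"
  unfolding common_servers_def by measurable

lemma measurable_cell_pairs [measurable (raw)]:
  assumes [measurable]: "K \<in> measurable N configs" "L \<in> measurable N configs" "V \<in> measurable N configs"
    "W \<in> sets borel"
  shows "(\<lambda>z. cell_pairs c W (K z) (L z) (V z)) \<in> borel_measurable N"
  unfolding cell_pairs_def by measurable

lemma shadow_in_sets [measurable, simp]: "shadow c X u v \<in> sets borel"
  and bounded_shadow [simp]: "bounded (shadow c X u v)"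
  by (auto simp: shadow_def)

lemma measurable_measure_shadow [measurable (raw)]:
  assumes [measurable]: "X \<in> borel_measurable N" "u \<in> borel_measurable N" "v \<in> borel_measurable N"
  shows "(\<lambda>z. measure lborel (shadow c (X z) (u z) (v z))) \<in> borel_measurable N"
  unfolding measure_def
proof (intro borel_measurable_enn2real lborel.measurable_emeasure)
  show "{x \<in> space (N \<Otimes>\<^sub>M lborel). snd x \<in> shadow c (X (fst x)) (u (fst x)) (v (fst x))} \<in> sets (N \<Otimes>\<^sub>M lborel)"
    unfolding shadow_def Un_iff mem_ball by measurable
qed simp

text \<open>For \<open>c = 1\<close> the boundary circles pass through \<open>X\<close> and the
  discs are open. So \<open>X\<close> does not compete with itself, and \<open>S\<close> may be
  replaced by \<open>S - {X}\<close>, as Mecke's formula requires.\<close>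

lemma not_in_shadow_1: "X \<notin> shadow 1 X u v"
  by (simp add: shadow_def dist_commute)

text \<open>For a fixed countable \<open>S\<close> the other tier is integrated first and
  contributes a void probability for each \<open>X\<close>. What remains is a sum over
  \<open>X\<close> in \<open>S\<close> that depends on \<open>S - {X}\<close>, ready for Mecke's
  formula.\<close>

lemma expected_common_servers:
  assumes P1: "poisson_law P1 l1" and P2: "poisson_law P2 l2"
  shows "(\<integral>\<^sup>+ S. \<integral>\<^sup>+ T. common_servers c S T u v \<partial>P2 \<partial>P1) =
    ennreal l1 * (\<integral>\<^sup>+ x. ennreal (exp (- l1 * measure lborel (shadow 1 x u v)) *
      exp (- l2 * measure lborel (shadow c x u v))) \<partial>lborel)"
proof -
  interpret P1: poisson_law P1 l1 by fact
  interpret P2: poisson_law P2 l2 by fact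
  have void: "(\<integral>\<^sup>+ T. of_bool (T \<inter> shadow c X u v = {}) \<partial>P) = ennreal (exp (- l * measure lborel (shadow c X u v)))"
    if "poisson_law P l" for P l c X
  proof -
    interpret poisson_law P l by fact
    have "(\<integral>\<^sup>+ T. of_bool (T \<inter> shadow c X u v = {}) \<partial>P) =
        (\<integral>\<^sup>+ T. indicator {T \<in> space configs. T \<inter> shadow c X u v = {}} T \<partial>P)"
      by (intro nn_integral_cong) (auto simp: indicator_def)
    also have "\<dots> = emeasure P {T \<in> space configs. T \<inter> shadow c X u v = {}}"
      by (intro nn_integral_indicator) (simp add: void_in_sets_configs)
    finally show ?thesis by (simp add: emeasure_void)
  qed
  let ?e = "\<lambda>X. ennreal (exp (- l2 * measure lborel (shadow c X u v)))"
  have "(\<integral>\<^sup>+ S. \<integral>\<^sup>+ T. common_servers c S T u v \<partial>P2 \<partial>P1) =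
      (\<integral>\<^sup>+ S. \<integral>\<^sup>+ X. of_bool ((S - {X}) \<inter> shadow 1 X u v = {}) * ?e X \<partial>count_space S \<partial>P1)"
  proof (rule nn_integral_cong)
    fix S assume "S \<in> space P1"
    then have S: "S \<in> space configs" "countable S"
      by (simp_all add: space_configs countable_locally_finite)
    have eq: "(S - {X}) \<inter> shadow 1 X u v = S \<inter> shadow 1 X u v" for X
      using not_in_shadow_1 by blast
    have "(\<integral>\<^sup>+ T. common_servers c S T u v \<partial>P2) =
      (\<integral>\<^sup>+ X. \<integral>\<^sup>+ T. of_bool (S \<inter> shadow 1 X u v = {}) * of_bool (T \<inter> shadow c X u v = {}) \<partial>P2 \<partial>count_space S)"
      unfolding common_servers_def using S(1)
      by (intro nn_integral_count_space_nn_integral[OF S(2)]) measurable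
    also have "\<dots> = (\<integral>\<^sup>+ X. of_bool (S \<inter> shadow 1 X u v = {}) * ?e X \<partial>count_space S)"
      by (subst nn_integral_cmult, measurable) (simp add: void[OF P2])
    finally show "(\<integral>\<^sup>+ T. common_servers c S T u v \<partial>P2) =
       (\<integral>\<^sup>+ X. of_bool ((S - {X}) \<inter> shadow 1 X u v = {}) * ?e X \<partial>count_space S)"
      unfolding eq .
  qed
  also have "\<dots> = ennreal l1 * (\<integral>\<^sup>+ X. \<integral>\<^sup>+ S. of_bool (S \<inter> shadow 1 X u v = {}) * ?e X \<partial>P1 \<partial>lborel)"
    by (rule P1.mecke) measurable
  also have "\<dots> = ennreal l1 * (\<integral>\<^sup>+ X. ennreal (exp (- l1 * measure lborel (shadow 1 X u v))) * ?e X \<partial>lborel)"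
    by (subst nn_integral_multc, measurable) (simp add: void[OF P1])
  finally show ?thesis by (simp add: ennreal_mult')
qed

text \<open>Second factorial moment of the users: Mecke's formula for \<open>u\<close> replaces
  \<open>V - {u}\<close> by \<open>V\<close>, and a second use for \<open>v\<close>, with an
  integrand independent of the configuration, is Campbell's formula.\<close>

lemma expected_cell_pairs_given_stations:
  assumes P3: "poisson_law P3 l3" and [measurable]: "W \<in> sets borel"
    and S: "S \<in> space configs" and T: "T \<in> space configs"
  shows "(\<integral>\<^sup>+ V. cell_pairs c W S T V \<partial>P3) =
    ennreal l3 * (ennreal l3 * (\<integral>\<^sup>+ u. \<integral>\<^sup>+ v. indicator W u * common_servers c S T u v \<partial>lborel \<partial>lborel))"
proof -
  interpret P3: poisson_law P3 l3 by fact
  have campbell: "(\<integral>\<^sup>+ V. \<integral>\<^sup>+ v. common_servers c S T u v \<partial>count_space V \<partial>P3) =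
      ennreal l3 * (\<integral>\<^sup>+ v. common_servers c S T u v \<partial>lborel)" for u
    using S T by (subst P3.mecke) (measurable, simp add: P3.emeasure_space_1 del: P3.space_eq)
  have "(\<integral>\<^sup>+ V. cell_pairs c W S T V \<partial>P3) =
     ennreal l3 * (\<integral>\<^sup>+ u. \<integral>\<^sup>+ V. indicator W u * (\<integral>\<^sup>+ v. common_servers c S T u v \<partial>count_space V) \<partial>P3 \<partial>lborel)"
    unfolding cell_pairs_def using S T by (intro P3.mecke) measurable
  also have "\<dots> = ennreal l3 * (\<integral>\<^sup>+ u. indicator W u * (\<integral>\<^sup>+ V. \<integral>\<^sup>+ v. common_servers c S T u v \<partial>count_space V \<partial>P3) \<partial>lborel)"
    using S T by (intro arg_cong2[where f = "(*)"] refl nn_integral_cong nn_integral_cmult) measurable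
  also have "\<dots> = ennreal l3 * (\<integral>\<^sup>+ u. indicator W u * (ennreal l3 * (\<integral>\<^sup>+ v. common_servers c S T u v \<partial>lborel)) \<partial>lborel)"
    by (simp only: campbell)
  also have "(\<integral>\<^sup>+ u. indicator W u * (ennreal l3 * (\<integral>\<^sup>+ v. common_servers c S T u v \<partial>lborel)) \<partial>lborel) =
      ennreal l3 * (\<integral>\<^sup>+ u. \<integral>\<^sup>+ v. indicator W u * common_servers c S T u v \<partial>lborel \<partial>lborel)"
  proof -
    have "indicator W u * (ennreal l3 * (\<integral>\<^sup>+ v. common_servers c S T u v \<partial>lborel)) =
        ennreal l3 * (\<integral>\<^sup>+ v. indicator W u * common_servers c S T u v \<partial>lborel)" for u
      using S T by (subst nn_integral_cmult) (measurable, simp add: ac_simps)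
    then show ?thesis
      using S T by (simp only:) (intro nn_integral_cmult, measurable)
  qed
  finally show ?thesis .
qed

section \<open>Moving the station to the origin\<close>

lemma nn_integral_lborel_reflect:
  fixes f :: "'a::euclidean_space \<Rightarrow> ennreal"
  assumes [measurable]: "f \<in> borel_measurable borel"
  shows "(\<integral>\<^sup>+ x. f (u - x) \<partial>lborel) = (\<integral>\<^sup>+ x. f x \<partial>lborel)"
proof -
  have "lborel = distr lborel borel (\<lambda>x :: 'a. u - x)"
    using lborel_affine[of "-1" u] by (simp add: density_1)
  then have "(\<integral>\<^sup>+ x. f x \<partial>lborel) = (\<integral>\<^sup>+ x. f x \<partial>distr lborel borel (\<lambda>x. u - x))" by simp
  also have "\<dots> = (\<integral>\<^sup>+ x. f (u - x) \<partial>lborel)" by (rule nn_integral_distr) measurable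
  finally show ?thesis by simp
qed

lemma nn_integral_lborel_translate:
  fixes f :: "'a::euclidean_space \<Rightarrow> ennreal"
  assumes [measurable]: "f \<in> borel_measurable borel"
  shows "(\<integral>\<^sup>+ x. f (x - u) \<partial>lborel) = (\<integral>\<^sup>+ x. f x \<partial>lborel)"
  using nn_integral_lborel_reflect[of "\<lambda>x. f (- x)" u] nn_integral_lborel_reflect[of f 0] by simp

text \<open>Seen from the station, the users sit at \<open>u - x\<close> and \<open>v - x\<close>,
  and each radius is \<open>c\<close> times the norm of the centre.\<close>

lemma measure_shadow: "measure lborel (shadow c x u v) = union_area c (u - x) (v - x)"
proof -
  have "(+) x ` (ball (u - x) (c * norm (u - x)) \<union> ball (v - x) (c * norm (v - x))) = shadow c x u v"
    by (simp add: image_Un ball_translation[symmetric] shadow_def dist_norm norm_minus_commute)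
  moreover have "measure lborel ((+) x ` A) = measure lborel A" if "A \<in> sets borel" for A :: "pt set"
  proof -
    \<comment> \<open>Translation invariance is taken from Lebesgue measure, which agrees with
      \<open>lborel\<close> on Borel sets; as a preimage under the inverse translation, the image is
      Borel.\<close>
    have "(+) x ` A = (\<lambda>y. - x + y) -` A"
    proof (intro set_eqI iffI)
      fix y assume "y \<in> (\<lambda>y. - x + y) -` A"
      then show "y \<in> (+) x ` A" by (intro image_eqI[of _ _ "- x + y"]) simp_all
    qed auto
    also have "\<dots> \<in> sets borel" by (rule measurable_sets_borel[OF _ that]) simp
    finally have "(+) x ` A \<in> sets borel" .
    then show ?thesis using measure_translation[of x A] that by (simp add: measure_completion)
  qed
  ultimately show ?thesis by (metis union_area_def borel_open open_Un open_ball)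
qed

lemma measurable_union_area [measurable (raw)]:
  assumes [measurable]: "x \<in> borel_measurable N" "y \<in> borel_measurable N"
  shows "(\<lambda>z. union_area c (x z) (y z)) \<in> borel_measurable N"
proof -
  have "(\<lambda>z. measure lborel (shadow c 0 (x z) (y z))) \<in> borel_measurable N" by measurable
  then show ?thesis by (simp add: measure_shadow)
qed

definition void_integral :: "real \<Rightarrow> real \<Rightarrow> real \<Rightarrow> ennreal" where
  "void_integral l1 l2 c = (\<integral>\<^sup>+ x. \<integral>\<^sup>+ y. ennreal (exp (- l1 * union_area 1 x y) * exp (- l2 * union_area c x y)) \<partial>lborel \<partial>lborel)"

lemma expected_cell_pairs:
  assumes P1: "poisson_law P1 l1" and P2: "poisson_law P2 l2" and P3: "poisson_law P3 l3"
    and W[measurable]: "W \<in> sets borel"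
  shows "(\<integral>\<^sup>+ S. \<integral>\<^sup>+ T. \<integral>\<^sup>+ V. cell_pairs c W S T V \<partial>P3 \<partial>P2 \<partial>P1) =
    ennreal l3 * (ennreal l3 * (ennreal l1 * (emeasure lborel W * void_integral l1 l2 c)))"
proof -
  interpret P1: poisson_law P1 l1 by fact
  interpret P2: poisson_law P2 l2 by fact
  interpret LL: sigma_finite_measure "lborel \<Otimes>\<^sub>M lborel :: (pt \<times> pt) measure"
    by (intro sigma_finite_pair_measure lborel.sigma_finite_measure_axioms)
  interpret LP1: pair_sigma_finite "lborel \<Otimes>\<^sub>M lborel :: (pt \<times> pt) measure" P1 ..
  interpret LP2: pair_sigma_finite "lborel \<Otimes>\<^sub>M lborel :: (pt \<times> pt) measure" P2 ..
  let ?L = "lborel \<Otimes>\<^sub>M lborel :: (pt \<times> pt) measure"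
  let ?F = "\<lambda>x y. ennreal (exp (- l1 * union_area 1 x y) * exp (- l2 * union_area c x y))"
  \<comment> \<open>With \<open>v\<close> innermost, it can be translated by the then fixed
    \<open>x\<close>; reflecting \<open>x\<close> afterwards removes \<open>u\<close>. The result is
    constant in \<open>u\<close>, so the window contributes only its area.\<close>
  have inner: "(\<integral>\<^sup>+ v. \<integral>\<^sup>+ x. ?F (u - x) (v - x) \<partial>lborel \<partial>lborel) = void_integral l1 l2 c" for u
  proof -
    have "(\<integral>\<^sup>+ v. \<integral>\<^sup>+ x. ?F (u - x) (v - x) \<partial>lborel \<partial>lborel) = (\<integral>\<^sup>+ x. \<integral>\<^sup>+ v. ?F (u - x) (v - x) \<partial>lborel \<partial>lborel)"
      by (rule lborel_pair.Fubini') measurable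
    also have "\<dots> = (\<integral>\<^sup>+ x. \<integral>\<^sup>+ y. ?F (u - x) y \<partial>lborel \<partial>lborel)"
      by (intro nn_integral_cong nn_integral_lborel_translate) measurable
    also have "\<dots> = void_integral l1 l2 c"
      unfolding void_integral_def by (rule nn_integral_lborel_reflect[where f = "\<lambda>x. \<integral>\<^sup>+ y. ?F x y \<partial>lborel"]) measurable
    finally show ?thesis .
  qed
  \<comment> \<open>The two users are bundled into one variable \<open>z\<close>, so that each tier
    is exchanged with both of them by a single use of Fubini.\<close>
  have "(\<integral>\<^sup>+ S. \<integral>\<^sup>+ T. \<integral>\<^sup>+ V. cell_pairs c W S T V \<partial>P3 \<partial>P2 \<partial>P1) =
    (\<integral>\<^sup>+ S. \<integral>\<^sup>+ T. ennreal l3 * (ennreal l3 * (\<integral>\<^sup>+ z. indicator W (fst z) * common_servers c S T (fst z) (snd z) \<partial>?L)) \<partial>P2 \<partial>P1)"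
  proof (intro nn_integral_cong)
    fix S T assume "S \<in> space P1" "T \<in> space P2"
    then have ST: "S \<in> space configs" "T \<in> space configs" by simp_all
    have "(\<integral>\<^sup>+ z. indicator W (fst z) * common_servers c S T (fst z) (snd z) \<partial>?L) =
       (\<integral>\<^sup>+ u. \<integral>\<^sup>+ v. indicator W u * common_servers c S T u v \<partial>lborel \<partial>lborel)"
    proof -
      have "(\<lambda>z. indicator W (fst z) * common_servers c S T (fst z) (snd z)) \<in> borel_measurable ?L"
        using ST by measurable
      from lborel.nn_integral_fst[OF this] show ?thesis by (simp only: fst_conv snd_conv)
    qed
    then show "(\<integral>\<^sup>+ V. cell_pairs c W S T V \<partial>P3) =
       ennreal l3 * (ennreal l3 * (\<integral>\<^sup>+ z. indicator W (fst z) * common_servers c S T (fst z) (snd z) \<partial>?L))"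
      by (simp only: expected_cell_pairs_given_stations[OF P3 W ST])
  qed
  also have "\<dots> = ennreal l3 * (ennreal l3 * (\<integral>\<^sup>+ S. \<integral>\<^sup>+ T. \<integral>\<^sup>+ z. indicator W (fst z) * common_servers c S T (fst z) (snd z) \<partial>?L \<partial>P2 \<partial>P1))"
  proof -
    have [measurable]: "(\<lambda>(S, T). \<integral>\<^sup>+ z. indicator W (fst z) * common_servers c S T (fst z) (snd z) \<partial>?L) \<in> borel_measurable (configs \<Otimes>\<^sub>M configs)"
      by measurable
    have "(\<integral>\<^sup>+ S. \<integral>\<^sup>+ T. a * g S T \<partial>P2 \<partial>P1) = a * (\<integral>\<^sup>+ S. \<integral>\<^sup>+ T. g S T \<partial>P2 \<partial>P1)"
      if [measurable]: "(\<lambda>(S, T). g S T) \<in> borel_measurable (configs \<Otimes>\<^sub>M configs)" for a and g :: "pt set \<Rightarrow> pt set \<Rightarrow> ennreal"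
    proof -
      have "(\<integral>\<^sup>+ S. \<integral>\<^sup>+ T. a * g S T \<partial>P2 \<partial>P1) = (\<integral>\<^sup>+ S. a * (\<integral>\<^sup>+ T. g S T \<partial>P2) \<partial>P1)"
        by (intro nn_integral_cong nn_integral_cmult) (simp; measurable)
      also have "\<dots> = a * (\<integral>\<^sup>+ S. \<integral>\<^sup>+ T. g S T \<partial>P2 \<partial>P1)"
        by (intro nn_integral_cmult) measurable
      finally show ?thesis .
    qed
    then show ?thesis by (simp add: mult.assoc[symmetric])
  qed
  also have "(\<integral>\<^sup>+ S. \<integral>\<^sup>+ T. \<integral>\<^sup>+ z. indicator W (fst z) * common_servers c S T (fst z) (snd z) \<partial>?L \<partial>P2 \<partial>P1) =
      (\<integral>\<^sup>+ S. \<integral>\<^sup>+ z. \<integral>\<^sup>+ T. indicator W (fst z) * common_servers c S T (fst z) (snd z) \<partial>P2 \<partial>?L \<partial>P1)"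
    by (intro nn_integral_cong LP2.Fubini') (simp; measurable)
  also have "\<dots> = (\<integral>\<^sup>+ z. \<integral>\<^sup>+ S. \<integral>\<^sup>+ T. indicator W (fst z) * common_servers c S T (fst z) (snd z) \<partial>P2 \<partial>P1 \<partial>?L)"
    by (rule LP1.Fubini') measurable
  also have "\<dots> = (\<integral>\<^sup>+ z. indicator W (fst z) * (\<integral>\<^sup>+ S. \<integral>\<^sup>+ T. common_servers c S T (fst z) (snd z) \<partial>P2 \<partial>P1) \<partial>?L)"
  proof (rule nn_integral_cong)
    fix z :: "pt \<times> pt"
    have "(\<integral>\<^sup>+ S. \<integral>\<^sup>+ T. indicator W (fst z) * common_servers c S T (fst z) (snd z) \<partial>P2 \<partial>P1) =
       (\<integral>\<^sup>+ S. indicator W (fst z) * (\<integral>\<^sup>+ T. common_servers c S T (fst z) (snd z) \<partial>P2) \<partial>P1)"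
      by (intro nn_integral_cong nn_integral_cmult) (simp; measurable)
    also have "\<dots> = indicator W (fst z) * (\<integral>\<^sup>+ S. \<integral>\<^sup>+ T. common_servers c S T (fst z) (snd z) \<partial>P2 \<partial>P1)"
      by (intro nn_integral_cmult) measurable
    finally show "(\<integral>\<^sup>+ S. \<integral>\<^sup>+ T. indicator W (fst z) * common_servers c S T (fst z) (snd z) \<partial>P2 \<partial>P1) =
       indicator W (fst z) * (\<integral>\<^sup>+ S. \<integral>\<^sup>+ T. common_servers c S T (fst z) (snd z) \<partial>P2 \<partial>P1)" .
  qed
  also have "\<dots> = (\<integral>\<^sup>+ z. indicator W (fst z) * (ennreal l1 * (\<integral>\<^sup>+ x. ?F (fst z - x) (snd z - x) \<partial>lborel)) \<partial>?L)"
    by (simp only: expected_common_servers[OF P1 P2] measure_shadow)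
  also have "\<dots> = (\<integral>\<^sup>+ u. \<integral>\<^sup>+ v. indicator W u * (ennreal l1 * (\<integral>\<^sup>+ x. ?F (u - x) (v - x) \<partial>lborel)) \<partial>lborel \<partial>lborel)"
  proof -
    have "(\<lambda>z. indicator W (fst z) * (ennreal l1 * (\<integral>\<^sup>+ x. ?F (fst z - x) (snd z - x) \<partial>lborel))) \<in> borel_measurable ?L"
      by measurable
    from lborel.nn_integral_fst[OF this] show ?thesis by (simp only: fst_conv snd_conv)
  qed
  also have "\<dots> = (\<integral>\<^sup>+ u. (ennreal l1 * void_integral l1 l2 c) * indicator W u \<partial>lborel)"
    by (intro nn_integral_cong) (simp add: nn_integral_cmult inner[simplified] mult.commute)
  also have "\<dots> = ennreal l1 * (emeasure lborel W * void_integral l1 l2 c)"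
    by (subst nn_integral_cmult_indicator) (simp_all add: ac_simps)
  finally show ?thesis .
qed

section \<open>Gaussian bounds and finiteness of the void integral\<close>

lemma nn_integral_exp_square_finite:
  fixes a :: real
  assumes "0 < a"
  shows "(\<integral>\<^sup>+ t. ennreal (exp (- a * t\<^sup>2)) \<partial>lborel) < \<infinity>"
proof -
  \<comment> \<open>The standard deviation for which
    \<open>1 / (2 * ?s\<^sup>2) = a\<close>.\<close>
  let ?s = "1 / sqrt (2 * a)"
  have "integrable lborel (\<lambda>t. sqrt (2 * pi * ?s\<^sup>2) * normal_density 0 ?s t)"
    using assms by (intro integrable_mult_right integrable_normal_density) simp
  moreover have "sqrt (2 * pi * ?s\<^sup>2) * normal_density 0 ?s t = exp (- a * t\<^sup>2)" for t
    using assms by (simp add: normal_density_def power_divide)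
  ultimately have "integrable lborel (\<lambda>t. exp (- a * t\<^sup>2))" by simp
  then show ?thesis by (simp add: integrable_iff_bounded)
qed

lemma nn_integral_exp_norm_square_finite:
  fixes a :: real
  assumes "0 < a"
  shows "(\<integral>\<^sup>+ x. ennreal (exp (- a * (norm x)\<^sup>2)) \<partial>(lborel :: pt measure)) < \<infinity>"
proof -
  let ?K = "\<integral>\<^sup>+ t. ennreal (exp (- a * t\<^sup>2)) \<partial>lborel"
  have "(\<integral>\<^sup>+ x. ennreal (exp (- a * (norm x)\<^sup>2)) \<partial>(lborel :: pt measure)) =
      (\<integral>\<^sup>+ x. ennreal (exp (- a * (fst x)\<^sup>2)) * ennreal (exp (- a * (snd x)\<^sup>2)) \<partial>(lborel \<Otimes>\<^sub>M lborel))"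
    unfolding lborel_prod
    by (intro nn_integral_cong) (simp add: norm_prod_def ennreal_mult[symmetric] exp_add[symmetric] algebra_simps)
  also have "\<dots> = (\<integral>\<^sup>+ s. \<integral>\<^sup>+ t. ennreal (exp (- a * s\<^sup>2)) * ennreal (exp (- a * t\<^sup>2)) \<partial>lborel \<partial>lborel)"
  proof -
    have "(\<lambda>x. ennreal (exp (- a * (fst x)\<^sup>2)) * ennreal (exp (- a * (snd x)\<^sup>2))) \<in> borel_measurable (lborel \<Otimes>\<^sub>M lborel)"
      by measurable
    from lborel.nn_integral_fst[OF this] show ?thesis by (simp only: fst_conv snd_conv)
  qed
  also have "\<dots> = ?K * ?K"
    by (simp add: nn_integral_cmult nn_integral_multc)
  finally show ?thesis
    using nn_integral_exp_square_finite[OF assms] by (simp add: ennreal_mult_less_top)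
qed

text \<open>The union is at least as large as each disc, hence as the mean of the two areas. The
  mean, unlike the maximum, turns the exponential into a product of a function of \<open>x\<close>
  and a function of \<open>y\<close>.\<close>

lemma union_area_lower_bound:
  "unit_ball_vol 2 / 2 * (norm x)\<^sup>2 + unit_ball_vol 2 / 2 * (norm y)\<^sup>2 \<le> union_area 1 x y"
proof -
  have fin: "ball x (norm x) \<union> ball y (norm y) \<in> fmeasurable lborel"
    by (intro fmeasurable.Un) (auto simp: fmeasurable_def emeasure_bounded_finite[unfolded infinity_ennreal_def])
  have "measure lborel (ball z (norm z)) = unit_ball_vol 2 * (norm z)\<^sup>2" for z :: pt
    by (simp add: content_ball power2_eq_square)
  moreover have "measure lborel (ball x (norm x)) \<le> union_area 1 x y"
    "measure lborel (ball y (norm y)) \<le> union_area 1 x y"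
    unfolding union_area_def using fin by (auto intro!: measure_mono_fmeasurable)
  ultimately show ?thesis by simp
qed

text \<open>The factor of the other tier is at most 1, and the factor of the serving tier is
  dominated by a product of two planar Gaussians.\<close>

lemma void_integral_finite:
  assumes "0 < l1" "0 \<le> l2"
  shows "void_integral l1 l2 c < \<infinity>"
proof -
  let ?a = "l1 * (unit_ball_vol 2 / 2)"
  let ?J = "\<integral>\<^sup>+ x. ennreal (exp (- ?a * (norm x)\<^sup>2)) \<partial>(lborel :: pt measure)"
  have "void_integral l1 l2 c \<le>
     (\<integral>\<^sup>+ x. \<integral>\<^sup>+ y. ennreal (exp (- ?a * (norm (x :: pt))\<^sup>2)) * ennreal (exp (- ?a * (norm (y :: pt))\<^sup>2)) \<partial>lborel \<partial>lborel)"
    unfolding void_integral_def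
  proof (intro nn_integral_mono)
    fix x y :: pt
    have "l1 * (unit_ball_vol 2 / 2 * (norm x)\<^sup>2 + unit_ball_vol 2 / 2 * (norm y)\<^sup>2) \<le> l1 * union_area 1 x y"
      using union_area_lower_bound[of x y] assms(1) by (intro mult_left_mono) auto
    then have "exp (- l1 * union_area 1 x y) \<le> exp (- ?a * (norm x)\<^sup>2) * exp (- ?a * (norm y)\<^sup>2)"
      by (simp add: exp_add[symmetric] algebra_simps)
    moreover have "exp (- l2 * union_area c x y) \<le> 1"
      using assms(2) by (simp add: union_area_def)
    ultimately have "exp (- l1 * union_area 1 x y) * exp (- l2 * union_area c x y) \<le>
        exp (- ?a * (norm x)\<^sup>2) * exp (- ?a * (norm y)\<^sup>2) * 1"
      by (intro mult_mono) auto
    then show "ennreal (exp (- l1 * union_area 1 x y) * exp (- l2 * union_area c x y)) \<le>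
        ennreal (exp (- ?a * (norm x)\<^sup>2)) * ennreal (exp (- ?a * (norm y)\<^sup>2))"
      by (simp add: ennreal_mult[symmetric] del: ennreal_mult)
  qed
  also have "\<dots> = ?J * ?J"
    by (simp add: nn_integral_cmult nn_integral_multc)
  also have "\<dots> < \<infinity>"
    using nn_integral_exp_norm_square_finite[of ?a] assms(1) by (simp add: ennreal_mult_less_top)
  finally show ?thesis .
qed

section \<open>Almost sure properties\<close>

context poisson_law
begin

text \<open>The expected number of points in \<open>N\<close> is \<open>lam\<close> times its
  measure, which is 0.\<close>

lemma AE_avoids_null_set:
  assumes N: "N \<in> null_sets lborel"
  shows "AE S in P. S \<inter> N = {}"
proof -
  have [measurable]: "N \<in> sets borel" using N by auto
  have "(\<integral>\<^sup>+ S. \<integral>\<^sup>+ x. indicator N x \<partial>count_space S \<partial>P) = ennreal lam * (\<integral>\<^sup>+ x. \<integral>\<^sup>+ S. indicator N x \<partial>P \<partial>lborel)"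
    by (rule mecke) measurable
  also have "\<dots> = 0" using N by (simp add: emeasure_space_1 null_setsD1 del: space_eq)
  finally have "AE S in P. (\<integral>\<^sup>+ x. indicator N x \<partial>count_space S) = 0"
    by (subst (asm) nn_integral_0_iff_AE) (simp; measurable)
  then show ?thesis
    by eventually_elim (auto simp: nn_integral_0_iff_AE AE_count_space split: split_indicator_asm)
qed

lemma AE_nonempty:
  assumes lam: "0 < lam"
  shows "AE S in P. S \<noteq> {}"
proof -
  let ?E = "{S \<in> space configs. S \<inter> (UNIV :: 'a set) = {}}"
  let ?b = "\<lambda>n. {S \<in> space configs. S \<inter> ball (0 :: 'a) (real n) = {}}"
  have b: "?b n \<in> sets configs" for n by (rule void_in_sets_configs) auto
  have E: "?E = (\<Inter>n. ?b n)"
    using reals_Archimedean2 by (auto simp: disjoint_iff)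
  then have E_sets: "?E \<in> sets configs" using b by (auto intro!: sets.countable_INT)
  let ?a = "lam * measure lborel (ball (0 :: 'a) 1)"
  have "0 < measure lborel (ball (0 :: 'a) 1)" by (simp add: content_ball_gt_0_iff)
  then have a: "0 < ?a" using lam by simp
  have "prob ?E \<le> exp (- ?a) ^ n" if "n \<ge> 1" for n
  proof -
    have "prob ?E \<le> prob (?b n)"
      by (rule finite_measure_mono) (use b in auto)
    also have "prob (?b n) = exp (- lam * measure lborel (ball (0 :: 'a) (real n)))"
      using emeasure_void[of "ball 0 (real n)"] by (simp add: emeasure_eq_measure)
    \<comment> \<open>Replacing the factor \<open>real n ^ DIM('a)\<close> by the smaller
      \<open>real n\<close> makes the bound a geometric sequence; this is where
      \<open>n \<ge> 1\<close> is used.\<close>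
    also have "\<dots> \<le> exp (- ?a * real n)"
    proof -
      have "real n \<le> real n ^ DIM('a)"
        using that by (intro self_le_power) auto
      then have "?a * real n \<le> lam * (measure lborel (ball (0 :: 'a) 1) * real n ^ DIM('a))"
        using a by (simp add: mult.assoc mult_left_mono lam_nonneg)
      moreover have "measure lborel (ball (0 :: 'a) (real n)) = measure lborel (ball (0 :: 'a) 1) * real n ^ DIM('a)"
        by (simp add: content_ball)
      ultimately show ?thesis by simp
    qed
    also have "\<dots> = exp (- ?a) ^ n" by (simp only: mult.commute[of _ "real n"] exp_of_nat_mult)
    finally show ?thesis .
  qed
  moreover have "(\<lambda>n. exp (- ?a) ^ n) \<longlonglongrightarrow> 0" using a by (intro LIMSEQ_realpow_zero) auto
  ultimately have "prob ?E \<le> 0" by (intro LIMSEQ_le_const[of _ 0]) auto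
  then have "prob ?E = 0" using measure_nonneg[of P ?E] by linarith
  then have "emeasure P ?E = 0" by (simp add: emeasure_eq_measure)
  then have "?E \<in> null_sets P" using E_sets by (simp add: null_sets_def)
  from AE_not_in[OF this] show ?thesis by (rule AE_mp) (auto simp: space_configs)
qed

lemma expected_card:
  assumes "W \<in> sets borel" "bounded W"
  shows "(\<integral>\<^sup>+ S. of_nat (card (S \<inter> W)) \<partial>P) = ennreal (lam * measure lborel W)"
proof -
  have "(\<integral>\<^sup>+ S. of_nat (card (S \<inter> W)) \<partial>P) = (\<integral>\<^sup>+ S. of_nat (card (S \<inter> W)) * indicator {S \<in> space configs. S \<inter> {} = {}} S \<partial>P)"
    by (intro nn_integral_cong) simp
  then show ?thesis using nn_integral_count_void[of "{}" W] assms by simp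
qed

end

lemma null_set_bisector:
  fixes X Y :: "'a::euclidean_space"
  assumes "X \<noteq> Y"
  shows "{u. dist X u = dist Y u} \<in> null_sets lborel"
proof -
  \<comment> \<open>Squaring the distances cancels \<open>u \<bullet> u\<close> and leaves a
    hyperplane, whose normal is nonzero because \<open>X \<noteq> Y\<close>.\<close>
  have "{u. dist X u = dist Y u} = {u. (2 *\<^sub>R (Y - X)) \<bullet> u = Y \<bullet> Y - X \<bullet> X}"
    by (auto simp: dist_norm norm_eq algebra_simps inner_commute)
  moreover have "negligible {u. (2 *\<^sub>R (Y - X)) \<bullet> u = Y \<bullet> Y - X \<bullet> X}"
    using assms by (intro negligible_hyperplane) simp
  moreover have "closed {u. dist X u = dist Y u}" by (intro closed_Collect_eq continuous_intros)
  ultimately show ?thesis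
    by (simp add: negligible_iff_null_sets null_sets_completion_iff)
qed

lemma null_set_sphere: "sphere (a :: 'a::euclidean_space) r \<in> null_sets lborel"
  using negligible_sphere[of a r] by (simp add: negligible_iff_null_sets null_sets_completion_iff)

lemma (in poisson_law) AE_no_ties:
  assumes "countable S"
  shows "AE V in P. \<forall>u\<in>V. \<forall>X\<in>S. \<forall>Y\<in>S - {X}. dist X u \<noteq> dist Y u"
proof -
  have "(\<Union>X\<in>S. \<Union>Y\<in>S - {X}. {u. dist X u = dist Y u}) \<in> null_sets lborel"
    using assms by (intro null_sets_UN' null_set_bisector) auto
  from AE_avoids_null_set[OF this] show ?thesis
    by eventually_elim blast
qed

text \<open>Here the second tier is random and the users are fixed. The tie locus of
  \<open>Y\<close> is then a sphere around \<open>u\<close> for every \<open>c\<close>; as a locus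
  of \<open>u\<close> it would depend on \<open>c\<close> and be the whole plane for
  \<open>c = 1\<close> and \<open>X = Y\<close>.\<close>

lemma (in poisson_law) AE_no_cross_ties:
  assumes "countable S" "countable V"
  shows "AE T in P. \<forall>u\<in>V. \<forall>X\<in>S. \<forall>Y\<in>T. c * dist X u \<noteq> dist Y u"
proof -
  have "(\<Union>u\<in>V. \<Union>X\<in>S. sphere u (c * dist X u)) \<in> null_sets lborel"
    using assms by (intro null_sets_UN' null_set_sphere) auto
  from AE_avoids_null_set[OF this] show ?thesis
  proof eventually_elim
    case (elim T)
    show ?case
    proof (intro ballI notI)
      fix u X Y assume *: "u \<in> V" "X \<in> S" "Y \<in> T" "c * dist X u = dist Y u"
      then have "Y \<in> sphere u (c * dist X u)" by (simp add: dist_commute[of u Y])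
      then show False using elim * by blast
    qed
  qed
qed

lemma (in poisson_law) AE_disjoint:
  assumes "countable S"
  shows "AE T in P. S \<inter> T = {}"
proof -
  have "(\<Union>x\<in>S. {x}) \<in> null_sets lborel"
    using assms by (intro null_sets_UN') auto
  from AE_avoids_null_set[OF this] show ?thesis
    by eventually_elim auto
qed

lemma nn_integral_eq_0I: "AE x in N. f x = 0 \<Longrightarrow> (\<integral>\<^sup>+ x. f x \<partial>N) = (0 :: ennreal)"
  using nn_integral_cong_AE[of f "\<lambda>_. 0" N] by simp

text \<open>Recasts the absence of violations as the vanishing of a sum, which is measurable by the
  rules above and can be integrated. The set \<open>D x\<close> may depend on \<open>x\<close> in
  order to leave out \<open>x\<close> itself.\<close>

lemma sum_pairs_eq_0_iff:
  fixes P :: "'u \<Rightarrow> 'x \<Rightarrow> 'y \<Rightarrow> bool"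
  shows "(\<integral>\<^sup>+ u. \<integral>\<^sup>+ x. \<integral>\<^sup>+ y. of_bool (P u x y) \<partial>count_space (D x) \<partial>count_space S \<partial>count_space V) = (0 :: ennreal)
    \<longleftrightarrow> (\<forall>u\<in>V. \<forall>x\<in>S. \<forall>y\<in>D x. \<not> P u x y)"
  by (simp add: nn_integral_0_iff_AE AE_count_space)

lemma square_measure:
  defines "W \<equiv> {0..1::real} \<times> {0..1::real}"
  shows "W \<in> sets borel" "bounded W" "emeasure lborel W = 1" "measure lborel W = 1"
proof -
  show "W \<in> sets borel" unfolding W_def by (intro borel_closed closed_Times) auto
  show "bounded W" unfolding W_def by (intro bounded_Times) auto
  have "emeasure lborel W = emeasure (lborel \<Otimes>\<^sub>M lborel) W" by (simp add: lborel_prod)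
  also have "\<dots> = 1" unfolding W_def by (subst lborel.emeasure_pair_measure_Times) auto
  finally show "emeasure lborel W = 1" .
  then show "measure lborel W = 1" by (simp add: measure_def)
qed

section \<open>Palm expectation\<close>

context
  fixes M :: "'w measure" and Mac Mic U :: "'w \<Rightarrow> pt set" and l1 l2 l3 :: real
  assumes M: "prob_space M" and pos: "0 < l1" "0 < l2" "0 < l3"
    and PPP: "is_PPP M l1 Mac" "is_PPP M l2 Mic" "is_PPP M l3 U"
    and indep: "indep_pp3 M Mac Mic U"
begin

interpretation prob_space M by (rule M)

abbreviation "law \<Phi> \<equiv> distr M configs \<Phi>"

interpretation PMac: poisson_law "law Mac" l1 using is_PPP_poisson_law[OF PPP(1)] pos by simp
interpretation PMic: poisson_law "law Mic" l2 using is_PPP_poisson_law[OF PPP(2)] pos by simp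
interpretation PU: poisson_law "law U" l3 using is_PPP_poisson_law[OF PPP(3)] pos by simp

lemma measurable_processes [measurable]:
  "Mac \<in> measurable M configs" "Mic \<in> measurable M configs" "U \<in> measurable M configs"
  using PPP is_PPP_measurable by blast+

text \<open>Passes from conditional to joint null events: with the first tier frozen it suffices to
  integrate over the other two laws, and a nonnegative function with zero expectation vanishes
  almost surely.\<close>

lemma AE_eq_0I:
  assumes [measurable]: "(\<lambda>(S, T, V). f S T V) \<in> borel_measurable (configs \<Otimes>\<^sub>M configs \<Otimes>\<^sub>M configs)"
    and 0: "\<And>S. S \<in> space configs \<Longrightarrow> (\<integral>\<^sup>+ T. \<integral>\<^sup>+ V. f S T V \<partial>law U \<partial>law Mic) = 0"
  shows "AE \<omega> in M. f (Mac \<omega>) (Mic \<omega>) (U \<omega>) = (0 :: ennreal)"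
proof -
  have "(\<lambda>\<omega>. (Mac \<omega>, Mic \<omega>, U \<omega>)) \<in> measurable M (configs \<Otimes>\<^sub>M configs \<Otimes>\<^sub>M configs)" by measurable
  from measurable_compose[OF this assms(1)]
  have [measurable]: "(\<lambda>\<omega>. f (Mac \<omega>) (Mic \<omega>) (U \<omega>)) \<in> borel_measurable M" by simp
  have "(\<integral>\<^sup>+ \<omega>. f (Mac \<omega>) (Mic \<omega>) (U \<omega>) \<partial>M) = (\<integral>\<^sup>+ S. \<integral>\<^sup>+ T. \<integral>\<^sup>+ V. f S T V \<partial>law U \<partial>law Mic \<partial>law Mac)"
    by (rule nn_integral_indep_pp3[OF PPP indep assms(1)])
  also have "\<dots> = (\<integral>\<^sup>+ S. 0 \<partial>law Mac)"
    by (intro nn_integral_cong 0) simp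
  finally have "(\<integral>\<^sup>+ \<omega>. f (Mac \<omega>) (Mic \<omega>) (U \<omega>) \<partial>M) = 0" by simp
  then show ?thesis by (subst (asm) nn_integral_0_iff_AE) simp_all
qed

lemma AE_no_ties_Mac: "AE \<omega> in M. \<forall>u\<in>U \<omega>. \<forall>X\<in>Mac \<omega>. \<forall>Y\<in>Mac \<omega> - {X}. dist X u \<noteq> dist Y u"
proof -
  have "AE \<omega> in M. (\<integral>\<^sup>+ u. \<integral>\<^sup>+ X. \<integral>\<^sup>+ Y. of_bool (dist X u = dist Y u) \<partial>count_space (Mac \<omega> - {X}) \<partial>count_space (Mac \<omega>) \<partial>count_space (U \<omega>)) = (0 :: ennreal)"
  proof (rule AE_eq_0I)
    fix S :: "pt set" assume "S \<in> space configs"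
    then have "countable S" by (simp add: space_configs countable_locally_finite)
    from PU.AE_no_ties[OF this]
    have "AE V in law U. (\<integral>\<^sup>+ u. \<integral>\<^sup>+ X. \<integral>\<^sup>+ Y. of_bool (dist X u = dist Y u) \<partial>count_space (S - {X}) \<partial>count_space S \<partial>count_space V) = (0 :: ennreal)"
      by (rule eventually_mono) (simp add: sum_pairs_eq_0_iff)
    from nn_integral_eq_0I[OF this]
    show "(\<integral>\<^sup>+ T. \<integral>\<^sup>+ V. \<integral>\<^sup>+ u. \<integral>\<^sup>+ X. \<integral>\<^sup>+ Y. of_bool (dist X u = dist Y u) \<partial>count_space (S - {X}) \<partial>count_space S \<partial>count_space V \<partial>law U \<partial>law Mic) = (0 :: ennreal)"
      by simp
  qed measurable
  then show ?thesis by (rule eventually_mono) (simp add: sum_pairs_eq_0_iff)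
qed

lemma AE_no_ties_Mic: "AE \<omega> in M. \<forall>u\<in>U \<omega>. \<forall>X\<in>Mic \<omega>. \<forall>Y\<in>Mic \<omega> - {X}. dist X u \<noteq> dist Y u"
proof -
  have "AE \<omega> in M. (\<integral>\<^sup>+ u. \<integral>\<^sup>+ X. \<integral>\<^sup>+ Y. of_bool (dist X u = dist Y u) \<partial>count_space (Mic \<omega> - {X}) \<partial>count_space (Mic \<omega>) \<partial>count_space (U \<omega>)) = (0 :: ennreal)"
  proof (rule AE_eq_0I[where f = "\<lambda>S T V. \<integral>\<^sup>+ u. \<integral>\<^sup>+ X. \<integral>\<^sup>+ Y. of_bool (dist X u = dist Y u) \<partial>count_space (T - {X}) \<partial>count_space T \<partial>count_space V"])
    fix S :: "pt set" assume "S \<in> space configs"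
    have "(\<integral>\<^sup>+ V. \<integral>\<^sup>+ u. \<integral>\<^sup>+ X. \<integral>\<^sup>+ Y. of_bool (dist X u = dist Y u) \<partial>count_space (T - {X}) \<partial>count_space T \<partial>count_space V \<partial>law U) = (0 :: ennreal)"
      if "T \<in> space (law Mic)" for T
    proof (rule nn_integral_eq_0I)
      have "countable T" using that by (simp add: space_configs countable_locally_finite)
      from PU.AE_no_ties[OF this]
      show "AE V in law U. (\<integral>\<^sup>+ u. \<integral>\<^sup>+ X. \<integral>\<^sup>+ Y. of_bool (dist X u = dist Y u) \<partial>count_space (T - {X}) \<partial>count_space T \<partial>count_space V) = (0 :: ennreal)"
        by (rule eventually_mono) (simp add: sum_pairs_eq_0_iff)
    qed
    then show "(\<integral>\<^sup>+ T. \<integral>\<^sup>+ V. \<integral>\<^sup>+ u. \<integral>\<^sup>+ X. \<integral>\<^sup>+ Y. of_bool (dist X u = dist Y u) \<partial>count_space (T - {X}) \<partial>count_space T \<partial>count_space V \<partial>law U \<partial>law Mic) = (0 :: ennreal)"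
      by (rule nn_integral_eq_0I[OF AE_I2])
  qed measurable
  then show ?thesis by (rule eventually_mono) (simp add: sum_pairs_eq_0_iff)
qed

lemma AE_no_ties_Mac_Mic: "AE \<omega> in M. \<forall>u\<in>U \<omega>. \<forall>X\<in>Mac \<omega>. \<forall>Y\<in>Mic \<omega>. c * dist X u \<noteq> dist Y u"
proof -
  have "AE \<omega> in M. (\<integral>\<^sup>+ u. \<integral>\<^sup>+ X. \<integral>\<^sup>+ Y. of_bool (c * dist X u = dist Y u) \<partial>count_space (Mic \<omega>) \<partial>count_space (Mac \<omega>) \<partial>count_space (U \<omega>)) = (0 :: ennreal)"
  proof (rule AE_eq_0I)
    fix S :: "pt set" assume S: "S \<in> space configs"
    let ?f = "\<lambda>T V. \<integral>\<^sup>+ u. \<integral>\<^sup>+ X. \<integral>\<^sup>+ Y. of_bool (c * dist X u = dist Y u) \<partial>count_space T \<partial>count_space S \<partial>count_space V"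
    interpret pair_sigma_finite "law U" "law Mic" ..
    \<comment> \<open>The exchange puts the micro tier innermost, so that the users are fixed when
      it is drawn, as \<open>AE_no_cross_ties\<close> demands.\<close>
    have "(\<integral>\<^sup>+ T. \<integral>\<^sup>+ V. ?f T V \<partial>law U \<partial>law Mic) = (\<integral>\<^sup>+ V. \<integral>\<^sup>+ T. ?f T V \<partial>law Mic \<partial>law U)"
      using S by (intro Fubini') measurable
    also have "\<dots> = (\<integral>\<^sup>+ V. 0 \<partial>law U)"
    proof (intro nn_integral_cong nn_integral_eq_0I)
      fix V assume "V \<in> space (law U)"
      then have "countable S" "countable V" using S by (simp_all add: space_configs countable_locally_finite)
      from PMic.AE_no_cross_ties[OF this, of c]
      show "AE T in law Mic. ?f T V = 0"
        by (rule eventually_mono) (simp add: sum_pairs_eq_0_iff)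
    qed
    finally show "(\<integral>\<^sup>+ T. \<integral>\<^sup>+ V. ?f T V \<partial>law U \<partial>law Mic) = (0 :: ennreal)" by simp
  qed measurable
  then show ?thesis by (rule eventually_mono) (simp add: sum_pairs_eq_0_iff)
qed

lemma AE_Mac_Mic_disjoint: "AE \<omega> in M. Mac \<omega> \<inter> Mic \<omega> = {}"
proof -
  have "AE \<omega> in M. (\<integral>\<^sup>+ X. \<integral>\<^sup>+ Y. of_bool (X = Y) \<partial>count_space (Mic \<omega>) \<partial>count_space (Mac \<omega>)) = (0 :: ennreal)"
  proof (rule AE_eq_0I[where f = "\<lambda>S T V. \<integral>\<^sup>+ X. \<integral>\<^sup>+ Y. of_bool (X = Y) \<partial>count_space T \<partial>count_space S"])
    fix S :: "pt set" assume "S \<in> space configs"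
    then have "countable S" by (simp add: space_configs countable_locally_finite)
    from PMic.AE_disjoint[OF this]
    have "AE T in law Mic. (\<integral>\<^sup>+ V. \<integral>\<^sup>+ X. \<integral>\<^sup>+ Y. of_bool (X = Y) \<partial>count_space T \<partial>count_space S \<partial>law U) = (0 :: ennreal)"
      by eventually_elim (auto simp: nn_integral_0_iff_AE AE_count_space)
    then show "(\<integral>\<^sup>+ T. \<integral>\<^sup>+ V. \<integral>\<^sup>+ X. \<integral>\<^sup>+ Y. of_bool (X = Y) \<partial>count_space T \<partial>count_space S \<partial>law U \<partial>law Mic) = (0 :: ennreal)"
      by (rule nn_integral_eq_0I)
  qed measurable
  then show ?thesis by eventually_elim (auto simp: nn_integral_0_iff_AE AE_count_space)
qed

lemma nn_integral_cell_pairs: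
  assumes [measurable]: "W \<in> sets borel"
  shows "(\<integral>\<^sup>+ \<omega>. cell_pairs c W (Mac \<omega>) (Mic \<omega>) (U \<omega>) \<partial>M) =
      ennreal l3 * (ennreal l3 * (ennreal l1 * (emeasure lborel W * void_integral l1 l2 c)))" (is ?th1)
    and "(\<integral>\<^sup>+ \<omega>. cell_pairs c W (Mic \<omega>) (Mac \<omega>) (U \<omega>) \<partial>M) =
      ennreal l3 * (ennreal l3 * (ennreal l2 * (emeasure lborel W * void_integral l2 l1 c)))" (is ?th2)
proof -
  have "(\<integral>\<^sup>+ \<omega>. cell_pairs c W (Mac \<omega>) (Mic \<omega>) (U \<omega>) \<partial>M) =
     (\<integral>\<^sup>+ S. \<integral>\<^sup>+ T. \<integral>\<^sup>+ V. cell_pairs c W S T V \<partial>law U \<partial>law Mic \<partial>law Mac)"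
    by (rule nn_integral_indep_pp3[OF PPP indep]) measurable
  also have "\<dots> = ennreal l3 * (ennreal l3 * (ennreal l1 * (emeasure lborel W * void_integral l1 l2 c)))"
    by (rule expected_cell_pairs) (unfold_locales, fact)
  finally show ?th1 .
  interpret pair_sigma_finite "law Mic" "law Mac" ..
  have "(\<integral>\<^sup>+ \<omega>. cell_pairs c W (Mic \<omega>) (Mac \<omega>) (U \<omega>) \<partial>M) =
     (\<integral>\<^sup>+ S. \<integral>\<^sup>+ T. \<integral>\<^sup>+ V. cell_pairs c W T S V \<partial>law U \<partial>law Mic \<partial>law Mac)"
    by (rule nn_integral_indep_pp3[OF PPP indep]) measurable
  also have "\<dots> = (\<integral>\<^sup>+ T. \<integral>\<^sup>+ S. \<integral>\<^sup>+ V. cell_pairs c W T S V \<partial>law U \<partial>law Mac \<partial>law Mic)"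
    by (rule Fubini') measurable
  also have "\<dots> = ennreal l3 * (ennreal l3 * (ennreal l2 * (emeasure lborel W * void_integral l2 l1 c)))"
    by (rule expected_cell_pairs) (unfold_locales, fact)
  finally show ?th2 .
qed

lemma AE_sum_users_in_cell:
  assumes P: "0 < Pmac" "0 < Pmic" "0 < \<beta>"
    and W: "W \<in> sets borel" "bounded W"
  shows "AE \<omega> in M. of_nat (\<Sum>u\<in>U \<omega> \<inter> W. users_in_cell (Mac \<omega>) (Mic \<omega>) (U \<omega>) Pmac Pmic \<beta> u) =
      of_nat (card (U \<omega> \<inter> W)) + cell_pairs ((Pmic / Pmac) powr (1 / \<beta>)) W (Mac \<omega>) (Mic \<omega>) (U \<omega>) +
      cell_pairs ((Pmac / Pmic) powr (1 / \<beta>)) W (Mic \<omega>) (Mac \<omega>) (U \<omega>)"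
proof -
  let ?c = "(Pmic / Pmac) powr (1 / \<beta>)" and ?d = "(Pmac / Pmic) powr (1 / \<beta>)"
  note [measurable] = W(1)
  have W_fin: "emeasure lborel W < \<infinity>" by (rule emeasure_bounded_finite[OF W(2)])
  \<comment> \<open>A finite expectation makes the number of pairs finite almost surely.\<close>
  have "AE \<omega> in M. cell_pairs ?c W (Mac \<omega>) (Mic \<omega>) (U \<omega>) \<noteq> \<infinity>"
    using W_fin void_integral_finite[of l1 l2 ?c] pos
    by (intro nn_integral_noteq_infinite) (simp_all add: nn_integral_cell_pairs ennreal_mult_eq_top_iff less_top)
  moreover have "AE \<omega> in M. cell_pairs ?d W (Mic \<omega>) (Mac \<omega>) (U \<omega>) \<noteq> \<infinity>"
    using W_fin void_integral_finite[of l2 l1 ?d] pos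
    by (intro nn_integral_noteq_infinite) (simp_all add: nn_integral_cell_pairs ennreal_mult_eq_top_iff less_top)
  moreover have "AE \<omega> in M. Mac \<omega> \<noteq> {}"
    by (rule AE_distrD[OF measurable_processes(1) PMac.AE_nonempty[OF pos(1)]])
  moreover have "AE \<omega> in M. Mic \<omega> \<noteq> {}"
    by (rule AE_distrD[OF measurable_processes(2) PMic.AE_nonempty[OF pos(2)]])
  ultimately show ?thesis
    using AE_no_ties_Mac AE_no_ties_Mic AE_no_ties_Mac_Mic[of ?c] AE_Mac_Mic_disjoint AE_space
  proof eventually_elim
    case (elim \<omega>)
    have lf: "locally_finite (Mac \<omega>)" "locally_finite (Mic \<omega>)" "locally_finite (U \<omega>)"
      using is_PPP_locally_finite[OF _ elim(9)] PPP by blast+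
    show ?case
    proof (rule sum_users_in_cell_eq[OF P _ elim(8) _ elim(1,2)])
      show "finite (U \<omega> \<inter> W)" using lf(3) W(2) by (simp add: locally_finite_def)
      fix u assume "u \<in> U \<omega>"
      then show "\<exists>!X. X \<in> Mac \<omega> \<union> Mic \<omega> \<and> u \<in> het_cell (Mac \<omega>) (Mic \<omega>) Pmac Pmic \<beta> X"
        using elim(5-7) by (intro ex1_server[OF P elim(8) lf(1) elim(3) lf(2) elim(4)]) blast+
    qed
  qed
qed

text \<open>The window has area 1, so the diagonal contributes the expected number \<open>l3\<close>
  of users in it, and each pair term carries \<open>l3\<close> twice. Division by \<open>l3\<close>
  leaves 1 and one factor \<open>l3\<close>.\<close>

lemma palm_users_het_eq:
  assumes P: "0 < Pmac" "0 < Pmic" "0 < \<beta>"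
  shows "palm_users_het M l3 Mac Mic U Pmac Pmic \<beta> =
    1 + ennreal (l3 * l1) * void_integral l1 l2 ((Pmic / Pmac) powr (1 / \<beta>))
      + ennreal (l3 * l2) * void_integral l2 l1 ((Pmac / Pmic) powr (1 / \<beta>))"
proof -
  let ?c = "(Pmic / Pmac) powr (1 / \<beta>)" and ?d = "(Pmac / Pmic) powr (1 / \<beta>)"
  let ?W = "{0..1::real} \<times> {0..1::real}"
  note [measurable] = square_measure(1)
  have [measurable]: "(\<lambda>S. card (S \<inter> ?W)) \<in> measurable configs (count_space UNIV)"
    by (rule measurable_card_configs[OF square_measure(1,2)])
  have "(\<integral>\<^sup>+ \<omega>. ennreal (real (\<Sum>u\<in>U \<omega> \<inter> ?W. users_in_cell (Mac \<omega>) (Mic \<omega>) (U \<omega>) Pmac Pmic \<beta> u)) \<partial>M) =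
     (\<integral>\<^sup>+ \<omega>. of_nat (card (U \<omega> \<inter> ?W)) + cell_pairs ?c ?W (Mac \<omega>) (Mic \<omega>) (U \<omega>) +
      cell_pairs ?d ?W (Mic \<omega>) (Mac \<omega>) (U \<omega>) \<partial>M)"
    unfolding ennreal_of_nat_eq_real_of_nat[symmetric]
    by (rule nn_integral_cong_AE[OF AE_sum_users_in_cell[OF P square_measure(1,2)]])
  also have "\<dots> = (\<integral>\<^sup>+ \<omega>. of_nat (card (U \<omega> \<inter> ?W)) \<partial>M) + (\<integral>\<^sup>+ \<omega>. cell_pairs ?c ?W (Mac \<omega>) (Mic \<omega>) (U \<omega>) \<partial>M) +
      (\<integral>\<^sup>+ \<omega>. cell_pairs ?d ?W (Mic \<omega>) (Mac \<omega>) (U \<omega>) \<partial>M)"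
    by (simp add: nn_integral_add)
  also have "(\<integral>\<^sup>+ \<omega>. of_nat (card (U \<omega> \<inter> ?W)) \<partial>M) = (\<integral>\<^sup>+ V. of_nat (card (V \<inter> ?W)) \<partial>law U)"
    by (simp add: nn_integral_distr)
  also have "\<dots> = ennreal l3"
    by (simp add: PU.expected_card[OF square_measure(1,2)] square_measure)
  finally have "palm_users_het M l3 Mac Mic U Pmac Pmic \<beta> =
     (ennreal l3 + ennreal l3 * (ennreal l3 * (ennreal l1 * void_integral l1 l2 ?c)) +
      ennreal l3 * (ennreal l3 * (ennreal l2 * void_integral l2 l1 ?d))) / ennreal l3"
    by (simp add: palm_users_het_def square_measure nn_integral_cell_pairs)
  also have "\<dots> = (1 + ennreal l3 * (ennreal l1 * void_integral l1 l2 ?c) +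
      ennreal l3 * (ennreal l2 * void_integral l2 l1 ?d)) * ennreal l3 / ennreal l3"
    by (simp add: distrib_left distrib_right mult.commute)
  also have "\<dots> = 1 + ennreal l3 * (ennreal l1 * void_integral l1 l2 ?c) +
      ennreal l3 * (ennreal l2 * void_integral l2 l1 ?d)"
    using pos(3) by (intro ennreal_mult_divide_eq) auto
  finally show ?thesis
    using pos by (simp add: ennreal_mult mult.assoc)
qed

end

theorem theorem7:
  fixes M :: "'w measure" and Mac Mic U :: "'w \<Rightarrow> pt set"
    and lamBS p Pmac Pmic \<beta> lamSU :: real
  assumes "prob_space M"
    and "lamBS > 0" and "0 < p" and "p < 1" and "Pmac > 0" and "Pmic > 0"
    and "\<beta> > 2" and "lamSU > 0"
    and "is_PPP M (p * lamBS) Mac"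
    and "is_PPP M ((1 - p) * lamBS) Mic"
    and "is_PPP M lamSU U"
    and "indep_pp3 M Mac Mic U"
  shows "palm_users_het M lamSU Mac Mic U Pmac Pmic \<beta>
     = 1
       + ennreal (lamSU * lamBS * p) *
         (\<integral>\<^sup>+ x. \<integral>\<^sup>+ y. ennreal (exp (- lamBS * p * union_area 1 x y)
             * exp (- lamBS * (1 - p) * union_area ((Pmic / Pmac) powr (1 / \<beta>)) x y)) \<partial>lborel \<partial>lborel)
       + ennreal (lamSU * lamBS * (1 - p)) *
         (\<integral>\<^sup>+ x. \<integral>\<^sup>+ y. ennreal (exp (- lamBS * (1 - p) * union_area 1 x y)
             * exp (- lamBS * p * union_area ((Pmac / Pmic) powr (1 / \<beta>)) x y)) \<partial>lborel \<partial>lborel)"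
proof -
  have "0 < p * lamBS" "0 < (1 - p) * lamBS" "0 < \<beta>" using assms by simp_all
  from palm_users_het_eq[OF assms(1) this(1,2) assms(8-12,5,6) this(3)]
  show ?thesis
    unfolding void_integral_def minus_mult_left[symmetric]
    by (simp only: mult.assoc mult.commute[of p lamBS] mult.commute[of "1 - p" lamBS])
qed

end
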